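(* Let $\mathcal H$ be an infinite-dimensional separable Hilbert lattice and let $C$ be a positive central operator on $\mathcal H$. Then $C$ is a sum of two positive self-commutators of positive operators, i.e. there exist positive operators $A$ and $B$ on $\mathcal H$ such that the operators $A^*A-AA^*$ and $B^*B-BB^*$ are positive and $$C=(A^*A-AA^* )+(B^*B-BB^* ).$$
   Context: A Hilbert lattice is a (real) Banach lattice whose norm is induced by an inner product; $A^*$ denotes the Hilbert space adjoint of $A$. An operator on a vector lattice is positive if it maps the positive cone into itself (this is not positive semi-definiteness). An operator $C$ on a vector lattice $L$ is central if there exists a positive real number $\lambda$ such that $|Cx|\le\lambda|x|$ for every $x\in L$. *)

theory Defs
  imports "HOL-Analysis.Analysis" "HOL-Library.Lattice_Algebras"
begin

class vector_lattice = ordered_real_vector + lattice_ab_group_add_abs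

class banach_lattice = banach + vector_lattice +
  assumes norm_lattice: "\<bar>x\<bar> \<le> \<bar>y\<bar> \<Longrightarrow> norm x \<le> norm y"

text \<open>The class \<open>real_inner\<close> makes the inner product induce the Banach lattice norm.\<close>

class hilbert_lattice = banach_lattice + real_inner

definition infinite_dimensional :: "'a::real_vector itself \<Rightarrow> bool" where
  "infinite_dimensional _ \<longleftrightarrow> \<not> (\<exists>S::'a set. finite S \<and> span S = UNIV)"

text \<open>Operators are everywhere defined linear maps. Boundedness is not part of the
  definition: positive operators on a Banach lattice are automatically bounded, and so are
  central ones.\<close>

definition positive_operator :: "('a::vector_lattice \<Rightarrow> 'a) \<Rightarrow> bool" where
  "positive_operator T \<longleftrightarrow> linear T \<and> (\<forall>x\<ge>0. 0 \<le> T x)"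

definition central_operator :: "('a::vector_lattice \<Rightarrow> 'a) \<Rightarrow> bool" where
  "central_operator C \<longleftrightarrow> linear C \<and> (\<exists>r::real. r > 0 \<and> (\<forall>x. \<bar>C x\<bar> \<le> r *\<^sub>R \<bar>x\<bar>))"

text \<open>The library's \<open>adjoint\<close> is the Hilbert space adjoint whenever the operator is bounded;
  otherwise its value is unspecified.\<close>

definition self_commutator :: "('a::real_inner \<Rightarrow> 'a) \<Rightarrow> 'a \<Rightarrow> 'a" where
  "self_commutator T = (\<lambda>x. adjoint T (T x) - T (adjoint T x))"

end

theory Submission
  imports Defs
begin

text \<open>
  Suppose that \<open>P\<close> is the projection onto a band whose complement contains infinitely many pairwise
  disjoint copies of that band. Write \<open>V\<^sub>n\<close>, \<open>n \<ge> 1\<close>, for the isometric embeddings, \<open>V\<^sub>0\<close> for the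
  inclusion of the band itself, and \<open>D\<close> for the positive square root of \<open>C\<close>, which is central and
  commutes with \<open>P\<close>. The weighted shift \<open>A\<close>, the sum of the \<open>V\<^bsub>n+1\<^esub> D V\<^sub>n\<^sup>*\<close>, is positive, and
  \<open>A\<^sup>*A\<close> and \<open>A A\<^sup>*\<close> are the sums of the \<open>V\<^sub>n C V\<^sub>n\<^sup>*\<close> over \<open>n \<ge> 0\<close> and over \<open>n \<ge> 1\<close>. Their difference
  telescopes to \<open>P C\<close>. If the roles of the band and its complement can also be exchanged, the same
  construction gives \<open>C - P C\<close>, and \<open>C\<close> is the sum of two positive self-commutators.

  All copies come from two positive isometries \<open>S\<close> and \<open>T\<close> of the whole lattice, one into the band and
  one into its complement: the ranges of \<open>T\<^sup>n S\<close>, \<open>n \<ge> 1\<close>, are pairwise orthogonal and lie in the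
  complement. Such a triple \<open>P\<close>, \<open>S\<close>, \<open>T\<close> is called \<open>complementary_copies\<close>, and
  \<open>sum_of_two_self_commutators\<close> carries out the reduction to it.

  To construct the triple, one works with the components \<open>p\<close> of a weak unit \<open>e\<close>, that is, \<open>p\<close> and
  \<open>e - p\<close> are disjoint; they play the role of measurable sets, with \<open>(norm p)\<^sup>2\<close> as the measure.
  Separability gives a binary tree of components whose levels are finer and finer partitions of \<open>e\<close> and
  span a dense subspace (\<open>component_tree_exists\<close>). A positive isometry can therefore be prescribed by
  mapping this tree to another tree of positive elements, of the same norms, whose nodes also split into
  disjoint parts (\<open>extend_isometry\<close>). If some nonzero component contains no atom, Sierpinski's argument (\<open>component_of_prescribed_norm\<close>) halves it,
  and each half contains an image of the full tree after rescaling (\<open>copies_if_nonatomic_component\<close>). Otherwise the normalised atoms form an orthonormal basis, which is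
  infinite and countable, and one sends it to its even and to its odd members (\<open>copies_if_atomic\<close>).
\<close>

section \<open>Order and inner product\<close>

text \<open>For \<open>x\<close> and \<open>y\<close> in the cone, \<open>\<bar>x - y\<bar> \<le> x + y\<close>. So the lattice norm of \<open>x - y\<close> is at most that of
  \<open>x + y\<close>, and the polarisation identity gives the sign of the inner product.\<close>

lemma inner_nonneg:
  fixes x y :: "'a::hilbert_lattice"
  assumes "0 \<le> x" "0 \<le> y"
  shows "0 \<le> x \<bullet> y"
proof -
  have "\<bar>x - y\<bar> \<le> \<bar>x\<bar> + \<bar>y\<bar>" by (rule abs_triangle_ineq4)
  also have "\<dots> = \<bar>x + y\<bar>" using assms by simp
  finally have "norm (x - y) \<le> norm (x + y)" by (rule norm_lattice)
  then have "(norm (x - y))\<^sup>2 \<le> (norm (x + y))\<^sup>2" by simp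
  then show ?thesis by (simp add: power2_norm_eq_inner algebra_simps inner_commute)
qed

lemma inner_mono:
  fixes x y z :: "'a::hilbert_lattice"
  assumes "x \<le> y" "0 \<le> z"
  shows "x \<bullet> z \<le> y \<bullet> z"
  using inner_nonneg[of "y - x" z] assms by (simp add: inner_diff_left)

lemma inner_mono_both:
  fixes x y z :: "'a::hilbert_lattice"
  assumes "0 \<le> x" "x \<le> x'" "0 \<le> y" "y \<le> y'"
  shows "x \<bullet> y \<le> x' \<bullet> y'"
proof -
  have "x \<bullet> y \<le> x' \<bullet> y" using assms by (intro inner_mono)
  also have "\<dots> \<le> x' \<bullet> y'"
    using inner_mono[of y y' x'] order_trans[OF assms(1,2)] assms(4) by (simp add: inner_commute)
  finally show ?thesis .
qed

lemma inner_zero_mono: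
  fixes x y z :: "'a::hilbert_lattice"
  assumes "x' \<bullet> y' = 0" "0 \<le> x" "x \<le> x'" "0 \<le> y" "y \<le> y'"
  shows "x \<bullet> y = 0"
  using inner_mono_both[OF assms(2-)] inner_nonneg[OF assms(2,4)] assms(1) by simp

text \<open>If \<open>x\<close> and \<open>y\<close> are disjoint, \<open>x - y\<close> and \<open>x + y\<close> have the same modulus, hence the same norm. With the
  converse below, disjointness of positive elements becomes the vanishing of an inner product, which
  is preserved by limits and by bilinear expansions.\<close>

lemma inner_eq_0_if_inf_eq_0:
  fixes x y :: "'a::hilbert_lattice"
  assumes "inf x y = 0"
  shows "x \<bullet> y = 0"
proof -
  have xy: "0 \<le> x" "0 \<le> y" using assms by (metis inf_le1, metis inf_le2)
  have "x - \<bar>x - y\<bar> \<le> x - (x - y)" by (intro diff_left_mono abs_ge_self)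
  moreover have "y - \<bar>x - y\<bar> \<le> y - (y - x)"
    using abs_ge_self[of "y - x"] by (intro diff_left_mono) (simp add: abs_minus_commute)
  ultimately have "x - \<bar>x - y\<bar> \<le> inf x y" "y - \<bar>x - y\<bar> \<le> inf x y"
    using abs_ge_zero[of "x - y"] by (simp_all add: diff_le_eq)
  then have "sup x y \<le> \<bar>x - y\<bar>" using assms by simp
  moreover have "\<bar>x + y\<bar> = x + y" using xy by simp
  moreover have "x + y = sup x y" using add_eq_inf_sup[of x y] assms by simp
  ultimately have "\<bar>x + y\<bar> \<le> \<bar>x - y\<bar>" by (simp only:)
  then have "norm (x + y) \<le> norm (x - y)" by (rule norm_lattice)
  then have "(norm (x + y))\<^sup>2 \<le> (norm (x - y))\<^sup>2" by simp
  then have "x \<bullet> y \<le> 0" by (simp add: power2_norm_eq_inner algebra_simps inner_commute)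
  with inner_nonneg[OF xy] show ?thesis by simp
qed

lemma inf_eq_0_if_inner_eq_0:
  fixes x y :: "'a::hilbert_lattice"
  assumes "x \<bullet> y = 0" "0 \<le> x" "0 \<le> y"
  shows "inf x y = 0"
  using inner_zero_mono[OF assms(1), of "inf x y" "inf x y"] assms by simp

lemma inner_pprt_pprt_uminus:
  fixes x :: "'a::hilbert_lattice"
  shows "pprt x \<bullet> pprt (- x) = 0"
proof (rule inner_eq_0_if_inf_eq_0)
  have e: "pprt (- x) = pprt x - x"
    using prts[of x] by (simp add: pprt_neg algebra_simps)
  have "inf (pprt x) (pprt x + - x) = pprt x + inf 0 (- x)"
    by (simp add: add_inf_distrib_left)
  also have "inf 0 (- x) = - pprt x" by (simp add: pprt_def inf_commute)
  finally show "inf (pprt x) (pprt (- x)) = 0" by (simp add: e)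
qed

lemma pprt_diff_pprt_uminus:
  fixes x :: "'a::hilbert_lattice"
  shows "x = pprt x - pprt (- x)"
  using prts[of x] by (simp add: pprt_neg algebra_simps)

text \<open>The cone is self-dual: the negative part of \<open>x\<close> is itself a test vector. This turns order
  statements about limits and adjoints into statements about inner products, so that continuity of the
  lattice operations is never an issue.\<close>

lemma nonneg_if_inner_nonneg:
  fixes x :: "'a::hilbert_lattice"
  assumes "\<And>y. 0 \<le> y \<Longrightarrow> 0 \<le> x \<bullet> y"
  shows "0 \<le> x"
proof -
  have "0 \<le> x \<bullet> pprt (- x)" by (rule assms) simp
  also have "\<dots> = - (pprt (- x) \<bullet> pprt (- x))"
    by (subst pprt_diff_pprt_uminus[of x]) (simp add: inner_diff_left inner_pprt_pprt_uminus)
  finally have "pprt (- x) \<bullet> pprt (- x) = 0"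
    using inner_ge_zero[of "pprt (- x)"] by linarith
  then have "pprt (- x) = 0" by simp
  then have "x = pprt x" using pprt_diff_pprt_uminus[of x] by simp
  then show ?thesis using zero_le_pprt[of x] by simp
qed

lemma LIMSEQ_nonneg:
  fixes X :: "nat \<Rightarrow> 'a::hilbert_lattice"
  assumes "X \<longlonglongrightarrow> x" "\<And>n. 0 \<le> X n"
  shows "0 \<le> x"
proof (rule nonneg_if_inner_nonneg)
  fix y :: 'a assume "0 \<le> y"
  then have "\<And>n. 0 \<le> X n \<bullet> y" using assms(2) by (simp add: inner_nonneg)
  moreover have "(\<lambda>n. X n \<bullet> y) \<longlonglongrightarrow> x \<bullet> y" by (intro tendsto_intros assms(1))
  ultimately show "0 \<le> x \<bullet> y" by (meson LIMSEQ_le_const)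
qed

section \<open>Limits of sequences of operators\<close>

lemma convergent_if_norm_diff_power2_le:
  fixes X :: "nat \<Rightarrow> 'a::banach" and f :: "nat \<Rightarrow> real"
  assumes le: "\<And>m n. n \<le> m \<Longrightarrow> (norm (X m - X n))\<^sup>2 \<le> f m - f n"
    and bound: "\<And>n. f n \<le> K"
  shows "convergent X"
proof -
  have "incseq f"
    using le by (intro incseq_SucI) (metis diff_ge_0_iff_ge le_SucI order_refl order_trans zero_le_power2)
  moreover have "bdd_above (range f)" using bound by (rule bdd_aboveI2)
  ultimately have "Cauchy f" by (metis LIMSEQ_incseq_SUP LIMSEQ_imp_Cauchy)
  have "Cauchy X"
  proof (rule metric_CauchyI)
    fix d :: real assume d: "0 < d"
    then obtain M where M: "\<And>m n. M \<le> m \<Longrightarrow> M \<le> n \<Longrightarrow> dist (f m) (f n) < d\<^sup>2"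
      using \<open>Cauchy f\<close> by (meson Cauchy_def zero_less_power)
    have *: "norm (X m - X n) < d" if "M \<le> n" "n \<le> m" for m n
    proof -
      have "(norm (X m - X n))\<^sup>2 < d\<^sup>2"
        using le[OF that(2)] M[of m n] that by (simp add: dist_real_def)
      then show ?thesis using d by (simp add: power2_less_imp_less)
    qed
    have "dist (X m) (X n) < d" if "M \<le> m" "M \<le> n" for m n
      using *[of n m] *[of m n] that by (cases "n \<le> m") (auto simp: dist_norm norm_minus_commute)
    then show "\<exists>M. \<forall>m\<ge>M. \<forall>n\<ge>M. dist (X m) (X n) < d" by blast
  qed
  then show ?thesis by (simp add: Cauchy_convergent)
qed

text \<open>For \<open>0 \<le> x \<le> y\<close> one has \<open>y \<bullet> x \<ge> x \<bullet> x\<close>, hence \<open>(norm (y - x))\<^sup>2 \<le> (norm y)\<^sup>2 - (norm x)\<^sup>2\<close>.\<close>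

lemma increasing_bounded_convergent:
  fixes X :: "nat \<Rightarrow> 'a::hilbert_lattice"
  assumes mono: "\<And>n. X n \<le> X (Suc n)" and nonneg: "\<And>n. 0 \<le> X n"
    and bound: "\<And>n. norm (X n) \<le> K"
  obtains x where "X \<longlonglongrightarrow> x" "\<And>n. X n \<le> x"
proof -
  have inc: "X n \<le> X m" if "n \<le> m" for n m using lift_Suc_mono_le[of X, OF mono that] .
  have "convergent X"
  proof (rule convergent_if_norm_diff_power2_le)
    fix m n :: nat assume "n \<le> m"
    have "X n \<bullet> X n \<le> X m \<bullet> X n" using inc[OF \<open>n \<le> m\<close>] nonneg by (intro inner_mono)
    then show "(norm (X m - X n))\<^sup>2 \<le> (norm (X m))\<^sup>2 - (norm (X n))\<^sup>2"
      by (simp add: power2_norm_eq_inner algebra_simps inner_commute)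
  next
    show "(norm (X n))\<^sup>2 \<le> K\<^sup>2" for n using bound[of n] by (simp add: power_mono)
  qed
  then obtain x where x: "X \<longlonglongrightarrow> x" by (auto simp: convergent_def)
  have "X n \<le> x" for n
  proof -
    have "(\<lambda>m. X (m + n) - X n) \<longlonglongrightarrow> x - X n"
      by (intro tendsto_intros LIMSEQ_ignore_initial_segment x)
    then have "0 \<le> x - X n" by (rule LIMSEQ_nonneg) (simp add: inc)
    then show ?thesis by simp
  qed
  with x that show thesis by blast
qed

lemma positive_operator_mono:
  "positive_operator T \<Longrightarrow> x \<le> y \<Longrightarrow> T x \<le> T y"
  unfolding positive_operator_def by (metis diff_ge_0_iff_ge linear_diff)

lemma strong_limit:
  fixes T :: "nat \<Rightarrow> 'a::hilbert_lattice \<Rightarrow> 'a"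
  assumes lin: "\<And>n. linear (T n)" and conv: "\<And>x. convergent (\<lambda>n. T n x)"
    and bound: "\<And>n x. norm (T n x) \<le> K * norm x"
  obtains L where "bounded_linear L" "\<And>x. (\<lambda>n. T n x) \<longlonglongrightarrow> L x"
proof
  define L where "L x = lim (\<lambda>n. T n x)" for x
  show L: "(\<lambda>n. T n x) \<longlonglongrightarrow> L x" for x
    using conv[of x] by (simp add: L_def convergent_LIMSEQ_iff)
  show "bounded_linear L"
  proof (rule bounded_linear_intro)
    show "L (x + y) = L x + L y" for x y
      using tendsto_add[OF L[of x] L[of y]] L[of "x + y"] linear_add[OF lin]
      by (simp add: LIMSEQ_unique)
    show "L (r *\<^sub>R x) = r *\<^sub>R L x" for r x
      using tendsto_scaleR[OF tendsto_const L[of x], of r] L[of "r *\<^sub>R x"] linear_cmul[OF lin]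
      by (simp add: LIMSEQ_unique)
    have "norm (L x) \<le> K * norm x" for x
      by (rule LIMSEQ_le_const2[OF tendsto_norm[OF L]]) (use bound in auto)
    then show "norm (L x) \<le> norm x * K" for x by (simp add: mult.commute)
  qed
qed

text \<open>Both the square root of \<open>C\<close> and the infinite sum of shifted copies arise as such limits.\<close>

lemma increasing_operators_strong_limit:
  fixes T :: "nat \<Rightarrow> 'a::hilbert_lattice \<Rightarrow> 'a"
  assumes pos: "\<And>n. positive_operator (T n)"
    and mono: "\<And>n x. 0 \<le> x \<Longrightarrow> T n x \<le> T (Suc n) x"
    and bound: "\<And>n x. norm (T n x) \<le> K * norm x"
  obtains L where "bounded_linear L" "positive_operator L" "\<And>x. (\<lambda>n. T n x) \<longlonglongrightarrow> L x"
proof -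
  have lin: "linear (T n)" for n using pos by (simp add: positive_operator_def)
  have nonneg: "0 \<le> T n x" if "0 \<le> x" for n x using pos that by (simp add: positive_operator_def)
  have conv_pos: "convergent (\<lambda>n. T n x)" if x: "0 \<le> x" for x
    using increasing_bounded_convergent[of "\<lambda>n. T n x" "K * norm x"] mono nonneg bound x
    by (metis convergentI)
  have "convergent (\<lambda>n. T n x)" for x
  proof -
    have "T n x = T n (pprt x) - T n (pprt (- x))" for n
      by (metis pprt_diff_pprt_uminus linear_diff[OF lin])
    then show ?thesis using convergent_diff[OF conv_pos conv_pos] by simp
  qed
  then obtain L where L: "bounded_linear L" "\<And>x. (\<lambda>n. T n x) \<longlonglongrightarrow> L x"
    using strong_limit[of T K, OF lin _ bound] by blast
  have "positive_operator L"
    using L LIMSEQ_nonneg[OF L(2)] nonneg by (simp add: positive_operator_def bounded_linear.linear)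
  with L that show thesis by blast
qed

section \<open>Adjoints\<close>

text \<open>The minimiser of \<open>x \<bullet> x - 2 * f x\<close> represents \<open>f\<close>, because the derivative vanishes there in every
  direction. A minimising sequence is Cauchy by the parallelogram law.\<close>

lemma riesz_representation:
  fixes f :: "'a::{real_inner, banach} \<Rightarrow> real"
  assumes f: "bounded_linear f"
  obtains y where "\<And>x. f x = x \<bullet> y"
proof -
  interpret f: bounded_linear f by fact
  obtain K where K: "\<And>x. norm (f x) \<le> norm x * K" using f.bounded by blast
  define J where "J x = x \<bullet> x - 2 * f x" for x
  have "- (K\<^sup>2) \<le> J x" for x
  proof -
    have "f x \<le> norm x * K" using K[of x] by (simp add: abs_le_iff)
    moreover have "0 \<le> (norm x - K)\<^sup>2" by simp
    ultimately show ?thesis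
      by (simp add: J_def power2_norm_eq_inner[symmetric] power2_diff)
  qed
  then have bdd: "bdd_below (range J)" by (metis bdd_belowI2)
  define m where "m = Inf (range J)"
  have m: "m \<le> J x" for x unfolding m_def by (intro cInf_lower bdd) auto
  have "\<exists>x. J x < m + 1 / real (Suc n)" for n
  proof -
    have "Inf (range J) < m + 1 / real (Suc n)" by (simp add: m_def)
    then show ?thesis by (metis cInf_lessD empty_not_UNIV image_is_empty rangeE)
  qed
  then obtain X where X: "\<And>n. J (X n) < m + 1 / real (Suc n)" by metis
  have par: "(norm (x - y))\<^sup>2 \<le> 2 * (J x - m) + 2 * (J y - m)" for x y
  proof -
    have "J x + J y - 2 * J ((1/2) *\<^sub>R (x + y)) = (norm (x - y))\<^sup>2 / 2"
      by (simp add: J_def power2_norm_eq_inner f.add f.scaleR f.diff algebra_simps inner_commute)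
    moreover have "m \<le> J ((1/2) *\<^sub>R (x + y))" by (rule m)
    moreover define M where "M = J ((1/2) *\<^sub>R (x + y))"
    ultimately show ?thesis unfolding M_def[symmetric] by simp
  qed
  have "Cauchy X"
  proof (rule metric_CauchyI)
    fix d :: real assume d: "0 < d"
    then have "0 < d\<^sup>2 / 4" by simp
    then obtain M where M: "1 / real (Suc M) < d\<^sup>2 / 4" using nat_approx_posE by blast
    have *: "J (X n) - m < d\<^sup>2 / 4" if "M \<le> n" for n
    proof -
      have "1 / real (Suc n) \<le> 1 / real (Suc M)" using that by (simp add: frac_le)
      with X[of n] M show ?thesis by linarith
    qed
    have "norm (X k - X n) < d" if "M \<le> k" "M \<le> n" for k n
    proof -
      have "(norm (X k - X n))\<^sup>2 < d\<^sup>2"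
        using par[of "X k" "X n"] *[OF that(1)] *[OF that(2)] by argo
      then show ?thesis using d by (simp add: power2_less_imp_less)
    qed
    then show "\<exists>M. \<forall>k\<ge>M. \<forall>n\<ge>M. dist (X k) (X n) < d" by (auto simp: dist_norm)
  qed
  then obtain y where y: "X \<longlonglongrightarrow> y" using Cauchy_convergent convergent_def by blast
  have lim_J: "(\<lambda>n. J (X n)) \<longlonglongrightarrow> J y"
    unfolding J_def by (intro tendsto_intros y f.tendsto)
  have "(\<lambda>n. m + 1 / real (Suc n)) \<longlonglongrightarrow> m + 0"
    by (intro tendsto_intros LIMSEQ_Suc[OF lim_1_over_n])
  from LIMSEQ_le[OF lim_J this] have Jy: "J y \<le> m" using X by (auto intro: less_imp_le)
  show thesis
  proof (rule that)
    fix x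
    define c where "c = f x - x \<bullet> y"
    show "f x = x \<bullet> y"
    proof (cases "x = 0")
      case False
      \<comment> \<open>The step length that minimises the quadratic polynomial \<open>t \<mapsto> J (y + t *\<^sub>R x)\<close>.\<close>
      define t where "t = c / (x \<bullet> x)"
      have xx: "x \<bullet> x > 0" using False by simp
      have "J (y + t *\<^sub>R x) = J y + t * t * (x \<bullet> x) - 2 * t * c"
        by (simp add: J_def c_def f.add f.scaleR inner_add_left inner_add_right
            inner_commute[of y x] right_diff_distrib distrib_left)
      moreover have "t * t * (x \<bullet> x) = t * c" using xx by (simp add: t_def)
      ultimately have "t * c \<le> 0" using m[of "y + t *\<^sub>R x"] Jy by linarith
      then have "c * c \<le> 0" using xx by (simp add: t_def divide_le_0_iff)
      then have "c = 0" by (auto simp: mult_le_0_iff)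
      then show ?thesis by (simp add: c_def)
    qed (simp add: f.zero)
  qed
qed

text \<open>\<open>T' y\<close> is the vector that represents the functional \<open>x \<mapsto> T x \<bullet> y\<close>.\<close>

lemma adjoint_exists:
  fixes T :: "'a::{real_inner, banach} \<Rightarrow> 'a"
  assumes T: "bounded_linear T"
  obtains T' where "bounded_linear T'" "\<And>x y. T x \<bullet> y = x \<bullet> T' y"
proof -
  interpret T: bounded_linear T by fact
  have "\<exists>z. \<forall>x. T x \<bullet> y = x \<bullet> z" for y
  proof -
    have "bounded_linear (\<lambda>x. T x \<bullet> y)" by (intro bounded_linear_intros T)
    then show ?thesis by (metis riesz_representation)
  qed
  then obtain T' where T': "\<And>x y. T x \<bullet> y = x \<bullet> T' y" by metis
  obtain K where K: "\<And>x. norm (T x) \<le> norm x * K" "K > 0" using T.pos_bounded by blast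
  have "bounded_linear T'"
  proof (rule bounded_linear_intro)
    show "T' (x + y) = T' x + T' y" for x y
    proof (rule vector_eq_ldot[THEN iffD1], rule allI)
      show "z \<bullet> T' (x + y) = z \<bullet> (T' x + T' y)" for z
        by (simp only: inner_add_right T'[symmetric])
    qed
    show "T' (r *\<^sub>R x) = r *\<^sub>R T' x" for r x
    proof (rule vector_eq_ldot[THEN iffD1], rule allI)
      show "z \<bullet> T' (r *\<^sub>R x) = z \<bullet> (r *\<^sub>R T' x)" for z
        by (simp only: inner_scaleR_right T'[symmetric])
    qed
    show "norm (T' y) \<le> norm y * K" for y
    proof (cases "T' y = 0")
      case False
      have "norm (T' y) * norm (T' y) = T (T' y) \<bullet> y"
        by (simp add: T' power2_norm_eq_inner flip: power2_eq_square)
      also have "\<dots> \<le> norm (T (T' y)) * norm y" by (rule norm_cauchy_schwarz)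
      also have "\<dots> \<le> norm (T' y) * K * norm y" by (intro mult_right_mono K) auto
      finally show ?thesis using False by (simp add: algebra_simps)
    qed (use K in simp)
  qed
  with T' that show thesis by blast
qed

lemma positive_adjoint:
  fixes T :: "'a::hilbert_lattice \<Rightarrow> 'a"
  assumes "positive_operator T" "linear T'" "\<And>x y. T x \<bullet> y = x \<bullet> T' y"
  shows "positive_operator T'"
  unfolding positive_operator_def
proof (intro conjI allI impI nonneg_if_inner_nonneg)
  fix x y :: 'a assume "0 \<le> x" "0 \<le> y"
  then have "0 \<le> T y \<bullet> x" using assms(1) by (simp add: inner_nonneg positive_operator_def)
  also have "\<dots> = T' x \<bullet> y" unfolding assms(3) by (rule inner_commute)
  finally show "0 \<le> T' x \<bullet> y" .
qed fact

section \<open>Square roots of central operators\<close>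

lemma positive_operator_compose:
  "positive_operator S \<Longrightarrow> positive_operator T \<Longrightarrow> positive_operator (\<lambda>x. S (T x))"
  unfolding positive_operator_def using linear_compose[of T S] by (simp add: o_def)

lemma positive_operator_add:
  "positive_operator S \<Longrightarrow> positive_operator T \<Longrightarrow> positive_operator (\<lambda>x. S x + T x)"
  unfolding positive_operator_def using linear_compose_add[of S T] by simp

lemma positive_operator_scaleR:
  "positive_operator T \<Longrightarrow> 0 \<le> (r::real) \<Longrightarrow> positive_operator (\<lambda>x. r *\<^sub>R T x)"
  unfolding positive_operator_def
  using linear_compose_scale_right[of T r] by (simp add: scaleR_nonneg_nonneg)

lemma norm_positive_operator_le:
  fixes T :: "'a::hilbert_lattice \<Rightarrow> 'a"
  assumes pos: "positive_operator T" and le: "\<And>x. 0 \<le> x \<Longrightarrow> T x \<le> r *\<^sub>R x" and r: "0 \<le> r"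
  shows "norm (T x) \<le> r * norm x"
proof -
  have lin: "linear T" using pos by (simp add: positive_operator_def)
  have "\<bar>T x\<bar> \<le> T \<bar>x\<bar>"
    using positive_operator_mono[OF pos abs_ge_self[of x]]
      positive_operator_mono[OF pos abs_ge_minus_self[of x]]
    by (intro abs_leI) (simp_all add: linear_neg[OF lin])
  also have "\<dots> \<le> r *\<^sub>R \<bar>x\<bar>" by (rule le) simp
  also have "\<dots> = \<bar>r *\<^sub>R \<bar>x\<bar>\<bar>"
    using r by (simp add: scaleR_nonneg_nonneg)
  finally have "norm (T x) \<le> r * norm \<bar>x\<bar>" using r norm_lattice[of "T x"] by fastforce
  also have "\<dots> \<le> r * norm x" using r by (intro mult_left_mono norm_lattice) simp_all
  finally show ?thesis .
qed

text \<open>\<open>D = I - Y\<close> is a square root of \<open>C\<close> precisely when \<open>Y = (B + Y\<^sup>2) / 2\<close> with \<open>B = I - C\<close>. Iterating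
  this equation from \<open>Y = 0\<close> gives positive operators below the identity. They increase, because
  \<open>Y \<mapsto> Y\<^sup>2\<close> is monotone on positive operators, so they converge strongly, and the limit inherits
  positivity, symmetry and the bound.\<close>

lemma square_root_of_contraction:
  fixes C :: "'a::hilbert_lattice \<Rightarrow> 'a"
  assumes C: "positive_operator C" and le: "\<And>x. 0 \<le> x \<Longrightarrow> C x \<le> x"
    and sa: "\<And>x y. C x \<bullet> y = x \<bullet> C y"
  obtains D where "positive_operator D" "\<And>x. 0 \<le> x \<Longrightarrow> D x \<le> x"
    "\<And>x y. D x \<bullet> y = x \<bullet> D y" "\<And>x. D (D x) = C x"
proof -
  define Y where "Y = rec_nat (\<lambda>x::'a. 0) (\<lambda>n Z x. (1/2) *\<^sub>R ((x - C x) + Z (Z x)))"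
  have Y0: "Y 0 = (\<lambda>x. 0)" and YS: "Y (Suc n) = (\<lambda>x. (1/2) *\<^sub>R ((x - C x) + Y n (Y n x)))" for n
    by (simp_all add: Y_def)
  have linC: "linear C" using C by (simp add: positive_operator_def)
  have B: "positive_operator (\<lambda>x. x - C x)"
    using linear_compose_sub[OF linear_id linC] le by (simp add: positive_operator_def id_def)
  have pos: "positive_operator (Y n)" for n
  proof (induction n)
    case 0 show ?case by (simp add: Y0 positive_operator_def linear_zero)
  next
    case (Suc n)
    show ?case unfolding YS
      by (rule positive_operator_scaleR[OF positive_operator_add[OF B
            positive_operator_compose[OF Suc Suc]]]) simp
  qed
  have lin: "linear (Y n)" for n using pos by (simp add: positive_operator_def)
  have ge0: "0 \<le> Y n x" if "0 \<le> x" for n x using pos that by (simp add: positive_operator_def)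
  have mono: "Y n x \<le> Y (Suc n) x" if "0 \<le> x" for n x
    using that
  proof (induction n arbitrary: x)
    case 0 show ?case using ge0[OF 0] by (simp add: Y0)
  next
    case (Suc n)
    have "Y n (Y n x) \<le> Y n (Y (Suc n) x)"
      by (rule positive_operator_mono[OF pos Suc.IH[OF Suc.prems]])
    also have "\<dots> \<le> Y (Suc n) (Y (Suc n) x)" by (rule Suc.IH[OF ge0[OF Suc.prems]])
    finally show ?case unfolding YS[of "Suc n"] unfolding YS[of n]
      by (intro scaleR_left_mono add_left_mono) (simp_all add: YS)
  qed
  have le1: "Y n x \<le> x" if "0 \<le> x" for n x
    using that
  proof (induction n arbitrary: x)
    case 0 then show ?case by (simp add: Y0)
  next
    case (Suc n)
    have "Y n (Y n x) \<le> x"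
      using Suc.IH[OF ge0[OF Suc.prems]] Suc.IH[OF Suc.prems] by (rule order_trans)
    moreover have "x - C x \<le> x" using C Suc.prems by (simp add: positive_operator_def)
    ultimately have "(1/2) *\<^sub>R ((x - C x) + Y n (Y n x)) \<le> (1/2) *\<^sub>R (x + x)"
      by (intro scaleR_left_mono add_mono) simp_all
    then show ?case by (simp add: YS flip: scaleR_2)
  qed
  have saY: "Y n x \<bullet> y = x \<bullet> Y n y" for n x y
    by (induction n arbitrary: x y)
      (simp_all add: Y0 YS inner_add_left inner_add_right inner_diff_left inner_diff_right sa)
  have norm: "norm (Y n x) \<le> 1 * norm x" for n x
    by (rule norm_positive_operator_le[OF pos]) (use le1 in auto)
  obtain L where L: "bounded_linear L" "positive_operator L" "\<And>x. (\<lambda>n. Y n x) \<longlonglongrightarrow> L x"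
    using increasing_operators_strong_limit[of Y 1, OF pos mono norm] by blast
  have YY: "(\<lambda>n. Y n (Y n x)) \<longlonglongrightarrow> L (L x)" for x
  proof -
    have "(\<lambda>n. norm (Y n x - L x)) \<longlonglongrightarrow> norm (L x - L x)" by (intro tendsto_intros L)
    then have "(\<lambda>n. norm (Y n x - L x)) \<longlonglongrightarrow> 0" by simp
    then have "(\<lambda>n. Y n (Y n x - L x)) \<longlonglongrightarrow> 0"
      by (rule Lim_null_comparison[rotated]) (use norm in simp)
    from tendsto_add[OF this L(3)[of "L x"]] show ?thesis
      by (simp add: linear_diff[OF lin])
  qed
  have fix_eq: "L x = (1/2) *\<^sub>R ((x - C x) + L (L x))" for x
  proof (rule LIMSEQ_unique)
    show "(\<lambda>n. Y (Suc n) x) \<longlonglongrightarrow> L x" by (rule LIMSEQ_Suc[OF L(3)])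
    show "(\<lambda>n. Y (Suc n) x) \<longlonglongrightarrow> (1/2) *\<^sub>R ((x - C x) + L (L x))"
      unfolding YS by (intro tendsto_intros YY)
  qed
  have linL: "linear L" using L(2) by (simp add: positive_operator_def)
  have Lle: "L x \<le> x" if "0 \<le> x" for x
  proof -
    have "(\<lambda>n. x - Y n x) \<longlonglongrightarrow> x - L x" by (intro tendsto_intros L)
    from LIMSEQ_nonneg[OF this] show ?thesis using le1[OF that] by simp
  qed
  show thesis
  proof (rule that[of "\<lambda>x. x - L x"])
    show "positive_operator (\<lambda>x. x - L x)"
      using linear_compose_sub[OF linear_id linL] Lle by (simp add: positive_operator_def id_def)
    show "x - L x \<le> x" if "0 \<le> x" for x using L(2) that by (simp add: positive_operator_def)
    have "L x \<bullet> y = x \<bullet> L y" for x y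
    proof (rule LIMSEQ_unique)
      show "(\<lambda>n. Y n x \<bullet> y) \<longlonglongrightarrow> L x \<bullet> y" by (intro tendsto_intros L)
      show "(\<lambda>n. Y n x \<bullet> y) \<longlonglongrightarrow> x \<bullet> L y" unfolding saY by (intro tendsto_intros L)
    qed
    then show "(x - L x) \<bullet> y = x \<bullet> (y - L y)" for x y
      by (simp add: inner_diff_left inner_diff_right)
    show "x - L x - L (x - L x) = C x" for x
    proof -
      have "2 *\<^sub>R L x = (x - C x) + L (L x)" by (subst fix_eq) simp
      then show ?thesis by (simp add: linear_diff[OF linL] scaleR_2 algebra_simps)
    qed
  qed
qed

lemma square_root:
  fixes C :: "'a::hilbert_lattice \<Rightarrow> 'a"
  assumes C: "positive_operator C" and r: "0 < r" and le: "\<And>x. 0 \<le> x \<Longrightarrow> C x \<le> r *\<^sub>R x"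
    and sa: "\<And>x y. C x \<bullet> y = x \<bullet> C y"
  obtains D where "positive_operator D" "\<And>x. 0 \<le> x \<Longrightarrow> D x \<le> sqrt r *\<^sub>R x"
    "\<And>x y. D x \<bullet> y = x \<bullet> D y" "\<And>x. D (D x) = C x"
proof -
  have "positive_operator (\<lambda>x. (1/r) *\<^sub>R C x)" using C r by (intro positive_operator_scaleR) simp_all
  moreover have "(1/r) *\<^sub>R C x \<le> x" if "0 \<le> x" for x
  proof -
    have "(1/r) *\<^sub>R C x \<le> (1/r) *\<^sub>R (r *\<^sub>R x)" using r by (intro scaleR_left_mono le that) simp
    then show ?thesis using r by simp
  qed
  moreover have "((1/r) *\<^sub>R C x) \<bullet> y = x \<bullet> ((1/r) *\<^sub>R C y)" for x y by (simp add: sa)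
  ultimately obtain E where E: "positive_operator E" "\<And>x. 0 \<le> x \<Longrightarrow> E x \<le> x"
    "\<And>x y. E x \<bullet> y = x \<bullet> E y" "\<And>x. E (E x) = (1/r) *\<^sub>R C x"
    using square_root_of_contraction[of "\<lambda>x. (1/r) *\<^sub>R C x"] by blast
  have lin: "linear E" using E(1) by (simp add: positive_operator_def)
  show thesis
  proof (rule that[of "\<lambda>x. sqrt r *\<^sub>R E x"])
    show "positive_operator (\<lambda>x. sqrt r *\<^sub>R E x)" using E(1) r by (intro positive_operator_scaleR) simp_all
    show "sqrt r *\<^sub>R E x \<le> sqrt r *\<^sub>R x" if "0 \<le> x" for x
      using E(2)[OF that] r by (intro scaleR_left_mono) simp_all
    show "(sqrt r *\<^sub>R E x) \<bullet> y = x \<bullet> (sqrt r *\<^sub>R E y)" for x y by (simp add: E(3))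
    show "sqrt r *\<^sub>R E (sqrt r *\<^sub>R E x) = C x" for x
      using r by (simp add: linear_cmul[OF lin] E(4))
  qed
qed

section \<open>Self-commutators from a pair of isometries\<close>

text \<open>\<open>G\<close> is the sum of the operators \<open>T\<^sup>n S R S' T'\<^sup>n\<close> over \<open>n \<ge> 1\<close>, that is, a copy of \<open>R\<close> on the range of
  every \<open>T\<^sup>n S\<close>. The sum is self-similar, which makes \<open>G\<close> a fixed point, and iteration from \<open>0\<close> produces
  the partial sums. They increase, and they are uniformly bounded since the ranges of \<open>S\<close> and \<open>T\<close> are
  orthogonal.\<close>

lemma shifted_copies_sum:
  fixes R S S' T T' :: "'a::hilbert_lattice \<Rightarrow> 'a"
  assumes R: "positive_operator R" and K: "0 \<le> K" "\<And>x. norm (R x) \<le> K * norm x"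
    and saR: "\<And>x y. R x \<bullet> y = x \<bullet> R y"
    and S: "positive_operator S" and S': "positive_operator S'" "\<And>x y. S x \<bullet> y = x \<bullet> S' y"
    and T: "positive_operator T" and T': "positive_operator T'" "\<And>x y. T x \<bullet> y = x \<bullet> T' y"
    and iso: "\<And>x. S' (S x) = x" "\<And>x. T' (T x) = x" and orth: "\<And>x. S' (T x) = 0"
  obtains G where "bounded_linear G" "positive_operator G" "\<And>x y. G x \<bullet> y = x \<bullet> G y"
    "\<And>x. G x = T (S (R (S' (T' x))) + G (T' x))"
proof -
  define G where "G = rec_nat (\<lambda>x::'a. 0) (\<lambda>n Z x. T (S (R (S' (T' x))) + Z (T' x)))"
  have G0: "G 0 = (\<lambda>x. 0)" and GS: "G (Suc n) = (\<lambda>x. T (S (R (S' (T' x))) + G n (T' x)))" for n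
    by (simp_all add: G_def)
  have linT: "linear T" using T by (simp add: positive_operator_def)
  have pos: "positive_operator (G n)" for n
  proof (induction n)
    case 0 show ?case by (simp add: G0 positive_operator_def linear_zero)
  next
    case (Suc n)
    have "positive_operator (\<lambda>x. T (S (R (S' x)) + G n x))"
      by (rule positive_operator_compose[OF T positive_operator_add[OF
              positive_operator_compose[OF S positive_operator_compose[OF R S'(1)]] Suc]])
    from positive_operator_compose[OF this T'(1)] show ?case by (simp add: GS)
  qed
  have lin: "linear (G n)" for n using pos by (simp add: positive_operator_def)
  have ge0: "0 \<le> G n x" if "0 \<le> x" for n x using pos that by (simp add: positive_operator_def)
  have T'0: "0 \<le> T' x" if "0 \<le> x" for x using T' that by (simp add: positive_operator_def)
  have mono: "G n x \<le> G (Suc n) x" if "0 \<le> x" for n x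
    using that
  proof (induction n arbitrary: x)
    case 0 show ?case using ge0[OF 0] by (simp add: G0)
  next
    case (Suc n)
    have "T (S (R (S' (T' x))) + G n (T' x)) \<le> T (S (R (S' (T' x))) + G (Suc n) (T' x))"
      using Suc.IH[OF T'0[OF Suc.prems]] by (intro positive_operator_mono[OF T] add_left_mono)
    then show ?case by (simp only: GS[of "Suc n"] GS[of n, THEN fun_cong])
  qed
  have normS: "norm (S x) = norm x" for x
    by (simp add: norm_eq_sqrt_inner S'(2) iso)
  have normT: "norm (T x) = norm x" for x
    by (simp add: norm_eq_sqrt_inner T'(2) iso)
  have linS: "linear S" using S by (simp add: positive_operator_def)
  have linS': "linear S'" using S' by (simp add: positive_operator_def)
  have linT': "linear T'" using T' by (simp add: positive_operator_def)
  have T'S: "T' (S x) = 0" for x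
  proof -
    have "y \<bullet> T' (S x) = y \<bullet> 0" for y
      by (metis S'(2) T'(2) inner_commute inner_zero_right orth)
    then show ?thesis using vector_eq_ldot by blast
  qed
  have bessel: "(norm (S' y))\<^sup>2 + (norm (T' y))\<^sup>2 \<le> (norm y)\<^sup>2" for y
  proof -
    have "S (S' y) \<bullet> y = (norm (S' y))\<^sup>2" "T (T' y) \<bullet> y = (norm (T' y))\<^sup>2"
      by (simp_all add: S'(2) T'(2) power2_norm_eq_inner)
    moreover have "S (S' y) \<bullet> S (S' y) = (norm (S' y))\<^sup>2" "T (T' y) \<bullet> T (T' y) = (norm (T' y))\<^sup>2"
      by (simp_all add: normS normT flip: power2_norm_eq_inner)
    moreover have "S (S' y) \<bullet> T (T' y) = 0" by (simp add: S'(2) orth)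
    moreover have "0 \<le> (y - S (S' y) - T (T' y)) \<bullet> (y - S (S' y) - T (T' y))" by simp
    ultimately show ?thesis
      by (simp add: inner_diff_left inner_diff_right inner_commute power2_norm_eq_inner[of y])
  qed
  have S'G: "S' (G n x) = 0" for n x
    by (cases n) (simp_all add: G0 GS orth linear_0[OF linS'])
  \<comment> \<open>The induction for the bound needs \<open>T' x\<close> rather than \<open>x\<close> on the right: the Bessel inequality
    then absorbs the new summand.\<close>
  have norm': "(norm (G n x))\<^sup>2 \<le> K\<^sup>2 * (norm (T' x))\<^sup>2" for n x
  proof (induction n arbitrary: x)
    case 0 show ?case by (simp add: G0)
  next
    case (Suc n)
    define y where "y = T' x"
    have "S (R (S' y)) \<bullet> G n y = 0" by (simp add: S'(2) S'G)
    then have "(norm (G (Suc n) x))\<^sup>2 = (norm (S (R (S' y))))\<^sup>2 + (norm (G n y))\<^sup>2"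
      unfolding GS normT y_def[symmetric]
      by (simp add: power2_norm_eq_inner inner_add_left inner_add_right inner_commute)
    also have "\<dots> \<le> (K * norm (S' y))\<^sup>2 + K\<^sup>2 * (norm (T' y))\<^sup>2"
      unfolding normS by (intro add_mono Suc power_mono K) simp
    also have "\<dots> = K\<^sup>2 * ((norm (S' y))\<^sup>2 + (norm (T' y))\<^sup>2)"
      by (simp add: power_mult_distrib distrib_left)
    also have "\<dots> \<le> K\<^sup>2 * (norm y)\<^sup>2" by (intro mult_left_mono bessel) simp
    finally show ?case by (simp add: y_def)
  qed
  have norm: "norm (G n x) \<le> K * norm x" for n x
  proof (rule power2_le_imp_le)
    have "(norm (T' x))\<^sup>2 \<le> (norm x)\<^sup>2" using bessel[of x] zero_le_power2[of "norm (S' x)"] by linarith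
    then have "K\<^sup>2 * (norm (T' x))\<^sup>2 \<le> K\<^sup>2 * (norm x)\<^sup>2" by (intro mult_left_mono) simp_all
    with norm'[of n x] show "(norm (G n x))\<^sup>2 \<le> (K * norm x)\<^sup>2"
      by (simp add: power_mult_distrib)
  qed (use K in simp)
  have saG: "G n x \<bullet> y = x \<bullet> G n y" for n x y
  proof (induction n arbitrary: x y)
    case 0 show ?case by (simp add: G0)
  next
    case (Suc n)
    have adj: "x \<bullet> T z = T' x \<bullet> z" "x \<bullet> S z = S' x \<bullet> z" for x z
      by (metis T'(2) inner_commute, metis S'(2) inner_commute)
    show ?case
      by (simp add: GS T'(2) adj inner_add_left inner_add_right S'(2) saR Suc)
  qed
  obtain L where L: "bounded_linear L" "positive_operator L" "\<And>x. (\<lambda>n. G n x) \<longlonglongrightarrow> L x"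
    using increasing_operators_strong_limit[of G K, OF pos mono norm] by blast
  have blT: "bounded_linear T"
    by (intro bounded_linear_intro[of T 1] linear_add[OF linT] linear_cmul[OF linT]) (simp add: normT)
  show thesis
  proof (rule that[OF L(1,2)])
    show "L x \<bullet> y = x \<bullet> L y" for x y
    proof (rule LIMSEQ_unique)
      show "(\<lambda>n. G n x \<bullet> y) \<longlonglongrightarrow> L x \<bullet> y" by (intro tendsto_intros L)
      show "(\<lambda>n. G n x \<bullet> y) \<longlonglongrightarrow> x \<bullet> L y" unfolding saG by (intro tendsto_intros L)
    qed
    show "L x = T (S (R (S' (T' x))) + L (T' x))" for x
    proof (rule LIMSEQ_unique)
      show "(\<lambda>n. G (Suc n) x) \<longlonglongrightarrow> L x" by (rule LIMSEQ_Suc[OF L(3)])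
      show "(\<lambda>n. G (Suc n) x) \<longlonglongrightarrow> T (S (R (S' (T' x))) + L (T' x))"
        unfolding GS by (intro bounded_linear.tendsto[OF blT] tendsto_intros L)
    qed
  qed
qed

text \<open>A positive operator dominated by a multiple of the identity does not move mass between disjoint
  bands: \<open>U D V \<le> k U V\<close>. Applied to a band projection and its complement, this shows that \<open>D\<close>
  commutes with the projection.\<close>

lemma central_sandwich_eq_0:
  fixes D U V :: "'a::hilbert_lattice \<Rightarrow> 'a"
  assumes D: "positive_operator D" "\<And>x. 0 \<le> x \<Longrightarrow> D x \<le> k *\<^sub>R x"
    and U: "positive_operator U" and V: "positive_operator V" and UV: "\<And>x. U (V x) = 0"
  shows "U (D (V x)) = 0"
proof -
  have lin: "linear U" "linear D" "linear V" using D U V by (simp_all add: positive_operator_def)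
  have *: "U (D (V y)) = 0" if y: "0 \<le> y" for y
  proof (rule order.antisym)
    have V0: "0 \<le> V y" and DV0: "0 \<le> D (V y)" using V D y by (simp_all add: positive_operator_def)
    show "0 \<le> U (D (V y))" using U DV0 by (simp add: positive_operator_def)
    have "U (D (V y)) \<le> U (k *\<^sub>R V y)"
      using D(2)[OF V0] by (rule positive_operator_mono[OF U])
    then show "U (D (V y)) \<le> 0" by (simp add: linear_cmul[OF lin(1)] UV)
  qed
  have "U (D (V (pprt x - pprt (- x)))) = 0"
    by (simp add: linear_diff[OF lin(1)] linear_diff[OF lin(2)] linear_diff[OF lin(3)] *)
  then show ?thesis by (simp flip: pprt_diff_pprt_uminus)
qed

lemma isometry_bounded_linear:
  fixes S :: "'a::real_inner \<Rightarrow> 'a"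
  assumes "linear S" "\<And>x y. S x \<bullet> S y = x \<bullet> y"
  shows "bounded_linear S"
  using assms
  by (intro bounded_linear_intro[of S 1]) (simp_all add: linear_add linear_cmul norm_eq_sqrt_inner)

text \<open>Here \<open>R = P D\<close> lives on the band of \<open>P\<close>, and \<open>A = T (S R + G)\<close> is the weighted shift: \<open>T S R\<close> moves
  the band to its first copy, and \<open>T G\<close> moves every copy to the next one. Since \<open>S R\<close> and \<open>G\<close> have
  orthogonal ranges and orthogonal supports, \<open>A\<^sup>*A = R\<^sup>2 + G\<^sup>2\<close>, whereas the fixed point equation for
  \<open>G\<close>, once squared, says \<open>A A\<^sup>* = G\<^sup>2\<close>.\<close>

lemma compression_is_self_commutator:
  fixes D P S T :: "'a::hilbert_lattice \<Rightarrow> 'a"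
  assumes D: "positive_operator D" "\<And>x. 0 \<le> x \<Longrightarrow> D x \<le> k *\<^sub>R x" "0 \<le> k"
    and saD: "\<And>x y. D x \<bullet> y = x \<bullet> D y"
    and P: "positive_operator P" "positive_operator (\<lambda>x. x - P x)"
    and saP: "\<And>x y. P x \<bullet> y = x \<bullet> P y" and PP: "\<And>x. P (P x) = P x"
    and S: "positive_operator S" "\<And>x y. S x \<bullet> S y = x \<bullet> y" "\<And>x. P (S x) = S x"
    and T: "positive_operator T" "\<And>x y. T x \<bullet> T y = x \<bullet> y" "\<And>x. P (T x) = 0"
  obtains A where "bounded_linear A" "positive_operator A"
    "self_commutator A = (\<lambda>x. P (D (D x)))"
proof -
  have lin: "linear P" "linear D" "linear S" "linear T"
    using P D S T by (simp_all add: positive_operator_def)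
  obtain S' where S': "bounded_linear S'" "\<And>x y. S x \<bullet> y = x \<bullet> S' y"
    using adjoint_exists[OF isometry_bounded_linear[OF lin(3) S(2)]] by blast
  obtain T' where T': "bounded_linear T'" "\<And>x y. T x \<bullet> y = x \<bullet> T' y"
    using adjoint_exists[OF isometry_bounded_linear[OF lin(4) T(2)]] by blast
  have posS': "positive_operator S'" and posT': "positive_operator T'"
    using S(1) S' T(1) T' by (auto intro: positive_adjoint bounded_linear.linear)
  note eqI = vector_eq_ldot[THEN iffD1, OF allI]
  have S'S: "S' (S x) = x" for x by (rule eqI) (simp add: S(2) flip: S'(2))
  have T'T: "T' (T x) = x" for x by (rule eqI) (simp add: T(2) flip: T'(2))
  have S'T: "S' (T x) = 0" for x
  proof (rule eqI)
    fix y
    have "S y \<bullet> T x = P (S y) \<bullet> T x" by (simp add: S(3))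
    also have "\<dots> = 0" by (simp add: saP T(3))
    finally show "y \<bullet> S' (T x) = y \<bullet> 0" by (simp flip: S'(2))
  qed
  have T'S: "T' (S x) = 0" for x
  proof (rule eqI)
    fix y
    have "T y \<bullet> S x = y \<bullet> T' (S x)" by (rule T')
    moreover have "S x \<bullet> T y = 0" by (simp add: S'(2) S'T)
    ultimately show "y \<bullet> T' (S x) = y \<bullet> 0" by (simp add: inner_commute)
  qed
  have PD: "P (D x) = D (P x)" for x
  proof -
    have "P (D (x - P x)) = 0"
      by (rule central_sandwich_eq_0[OF D(1,2) P(1) P(2)]) (simp_all add: linear_diff[OF lin(1)] PP)
    then have "P (D x) = P (D (P x))" by (simp add: linear_diff[OF lin(1)] linear_diff[OF lin(2)])
    moreover have "D (P x) - P (D (P x)) = 0"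
      by (rule central_sandwich_eq_0[OF D(1,2) P(2) P(1)]) (simp_all add: PP)
    ultimately show ?thesis by simp
  qed
  define R where "R x = P (D x)" for x
  have posR: "positive_operator R"
    using positive_operator_compose[OF P(1) D(1)] by (simp add: R_def[abs_def])
  have linR: "linear R" using posR by (simp add: positive_operator_def)
  have Rle: "R x \<le> k *\<^sub>R x" if "0 \<le> x" for x
  proof -
    have "0 \<le> D x - P (D x)" using P(2) D(1) that by (simp add: positive_operator_def)
    with D(2)[OF that] show ?thesis by (simp add: R_def)
  qed
  have saR: "R x \<bullet> y = x \<bullet> R y" for x y by (simp add: R_def saP saD PD)
  have RT: "R (T x) = 0" for x
    unfolding R_def by (rule central_sandwich_eq_0[OF D(1,2) P(1) T(1)]) (simp_all add: T(3))
  have RR: "R (R x) = P (D (D x))" for x by (simp add: R_def PD PP)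
  have normR: "norm (R x) \<le> k * norm x" for x
    by (rule norm_positive_operator_le[OF posR Rle D(3)])
  obtain G where G: "bounded_linear G" "positive_operator G" "\<And>x y. G x \<bullet> y = x \<bullet> G y"
    "\<And>x. G x = T (S (R (S' (T' x))) + G (T' x))"
    using shifted_copies_sum[OF posR D(3) normR saR S(1) posS' S'(2) T(1) posT' T'(2) S'S T'T S'T]
    by blast
  have linG: "linear G" using G(2) by (simp add: positive_operator_def)
  have S'G: "S' (G x) = 0" for x by (subst G(4)) (rule S'T)
  have T'G: "T' (G x) = S (R (S' (T' x))) + G (T' x)" for x by (subst G(4)) (rule T'T)
  have GS: "G (S x) = 0" for x
    by (subst G(4)) (simp add: T'S linear_0[OF lin(4)] linear_0[OF lin(3)] linear_0[OF linR]
        linear_0[OF linG] linear_0[OF bounded_linear.linear[OF S'(1)]])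
  have RG: "R (G x) = 0" for x by (subst G(4)) (rule RT)
  have GR: "G (R x) = 0" for x
  proof (rule eqI)
    show "y \<bullet> G (R x) = y \<bullet> 0" for y by (simp add: RG flip: G(3) saR)
  qed
  define A where "A x = T (S (R x) + G x)" for x
  define A' where "A' x = R (S' (T' x)) + G (T' x)" for x
  have posA: "positive_operator A"
    unfolding A_def[abs_def]
    by (rule positive_operator_compose[OF T(1) positive_operator_add[OF
            positive_operator_compose[OF S(1) posR] G(2)]])
  have blA: "bounded_linear A"
  proof -
    have "bounded_linear R" using normR
      by (intro bounded_linear_intro[of R k] linear_add[OF linR] linear_cmul[OF linR])
        (simp add: mult.commute)
    then show ?thesis unfolding A_def[abs_def]
      by (intro bounded_linear_compose[OF isometry_bounded_linear[OF lin(4) T(2)]]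
          bounded_linear_add bounded_linear_compose[OF isometry_bounded_linear[OF lin(3) S(2)]] G(1))
  qed
  have "A x \<bullet> y = x \<bullet> A' y" for x y
    by (simp add: A_def A'_def T'(2) inner_add_left inner_add_right S'(2) saR G(3))
  then have adj: "adjoint A = A'" by (intro adjoint_unique) simp
  have "self_commutator A x = P (D (D x))" for x
  proof -
    have "A' (A x) = R (R x) + G (G x)"
      by (simp add: A_def A'_def T'T linear_add[OF linR] linear_add[OF linG]
          linear_add[OF bounded_linear.linear[OF S'(1)]] S'S S'G GS linear_0[OF linR])
    moreover have "A (A' x) = G (G x)"
    proof -
      have "A (A' x) = T (S (R (R (S' (T' x)))) + G (G (T' x)))"
        by (simp add: A_def A'_def linear_add[OF linR] linear_add[OF linG] RG GR)
      also have "\<dots> = T (S (R (S' (T' (G x)))) + G (T' (G x)))"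
        by (simp add: T'G linear_add[OF linR] linear_add[OF linG] GS S'G S'S
            linear_add[OF bounded_linear.linear[OF S'(1)]])
      also have "\<dots> = G (G x)" by (rule G(4)[symmetric])
      finally show ?thesis .
    qed
    ultimately show ?thesis by (simp add: self_commutator_def adj RR)
  qed
  with that[OF blA posA] show thesis by blast
qed

text \<open>\<open>P\<close> is a band projection, and \<open>S\<close> and \<open>T\<close> embed the whole lattice isometrically into the band
  of \<open>P\<close> and into the complementary band.\<close>

definition complementary_copies ::
  "('a::hilbert_lattice \<Rightarrow> 'a) \<Rightarrow> ('a \<Rightarrow> 'a) \<Rightarrow> ('a \<Rightarrow> 'a) \<Rightarrow> bool" where
  "complementary_copies P S T \<longleftrightarrow>
     positive_operator P \<and> positive_operator (\<lambda>x. x - P x) \<and>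
     (\<forall>x y. P x \<bullet> y = x \<bullet> P y) \<and> (\<forall>x. P (P x) = P x) \<and>
     positive_operator S \<and> (\<forall>x y. S x \<bullet> S y = x \<bullet> y) \<and> (\<forall>x. P (S x) = S x) \<and>
     positive_operator T \<and> (\<forall>x y. T x \<bullet> T y = x \<bullet> y) \<and> (\<forall>x. P (T x) = 0)"

lemma sum_of_two_self_commutators:
  fixes C P S T :: "'a::hilbert_lattice \<Rightarrow> 'a"
  assumes C: "positive_operator C" "\<And>x. 0 \<le> x \<Longrightarrow> C x \<le> r *\<^sub>R x" "0 < r"
    and saC: "\<And>x y. C x \<bullet> y = x \<bullet> C y"
    and copies: "complementary_copies P S T"
  shows "\<exists>A B. bounded_linear A \<and> bounded_linear B \<and> positive_operator A \<and> positive_operator B \<and>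
      positive_operator (self_commutator A) \<and> positive_operator (self_commutator B) \<and>
      C = (\<lambda>x. self_commutator A x + self_commutator B x)"
proof -
  have P: "positive_operator P" "positive_operator (\<lambda>x. x - P x)"
    and saP: "\<And>x y. P x \<bullet> y = x \<bullet> P y" and PP: "\<And>x. P (P x) = P x"
    and S: "positive_operator S" "\<And>x y. S x \<bullet> S y = x \<bullet> y" "\<And>x. P (S x) = S x"
    and T: "positive_operator T" "\<And>x y. T x \<bullet> T y = x \<bullet> y" "\<And>x. P (T x) = 0"
    using copies by (simp_all add: complementary_copies_def)
  obtain D where D: "positive_operator D" "\<And>x. 0 \<le> x \<Longrightarrow> D x \<le> sqrt r *\<^sub>R x"
    and saD: "\<And>x y. D x \<bullet> y = x \<bullet> D y" and DD: "\<And>x. D (D x) = C x"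
    using square_root[OF C(1,3,2) saC] by blast
  have k: "0 \<le> sqrt r" using C(3) by simp
  have linP: "linear P" using P by (simp add: positive_operator_def)
  obtain A where A: "bounded_linear A" "positive_operator A" "self_commutator A = (\<lambda>x. P (D (D x)))"
    using compression_is_self_commutator[OF D k saD P saP PP S T] by blast
  define Q where "Q x = x - P x" for x
  have Q: "positive_operator Q" "positive_operator (\<lambda>x. x - Q x)"
    using P by (simp_all add: Q_def[abs_def])
  have "\<And>x y. Q x \<bullet> y = x \<bullet> Q y" "\<And>x. Q (Q x) = Q x" "\<And>x. Q (T x) = T x" "\<And>x. Q (S x) = 0"
    by (simp_all add: Q_def inner_diff_left inner_diff_right saP linear_diff[OF linP] PP T S)
  then obtain B where B: "bounded_linear B" "positive_operator B"
    "self_commutator B = (\<lambda>x. Q (D (D x)))"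
    using compression_is_self_commutator[OF D k saD Q _ _ T(1,2) _ S(1,2)] by blast
  have "positive_operator (self_commutator A)" "positive_operator (self_commutator B)"
    unfolding A(3) B(3) DD
    using positive_operator_compose[OF P(1) C(1)] positive_operator_compose[OF Q(1) C(1)] .
  moreover have "C = (\<lambda>x. self_commutator A x + self_commutator B x)"
    unfolding A(3) B(3) DD by (simp add: Q_def)
  ultimately show ?thesis using A(1,2) B(1,2) by blast
qed

section \<open>Operators given on refining orthogonal systems\<close>

text \<open>This covers two situations: the indicator-like components of finer and finer partitions, and the
  initial segments of an orthonormal basis. In both cases \<open>I n\<close> lists the members of the \<open>n\<close>-th
  finite orthogonal family, and \<open>refine\<close> says that each family lies in the span of the next one. As
  \<open>x / 0 = 0\<close>, members that are zero contribute nothing, so partitions may have empty cells.\<close>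

locale refining_system =
  fixes p :: "'i \<Rightarrow> 'a::hilbert_lattice" and I :: "nat \<Rightarrow> 'i set"
  assumes finite_level: "finite (I n)"
    and nonneg: "0 \<le> p s"
    and orth: "s \<in> I n \<Longrightarrow> t \<in> I n \<Longrightarrow> s \<noteq> t \<Longrightarrow> p s \<bullet> p t = 0"
    and refine: "s \<in> I n \<Longrightarrow> (\<Sum>t\<in>I (Suc n). ((p t \<bullet> p s) / (p t \<bullet> p t)) *\<^sub>R p t) = p s"
    and total: "(\<And>n s. s \<in> I n \<Longrightarrow> p s \<bullet> x = 0) \<Longrightarrow> x = 0"
begin

text \<open>For \<open>q = p\<close> this is the orthogonal projection onto the span of the \<open>n\<close>-th family. In general it is
  followed by the linear map that sends \<open>p\<close> to \<open>q\<close>.\<close>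

definition expand :: "('i \<Rightarrow> 'a) \<Rightarrow> nat \<Rightarrow> 'a \<Rightarrow> 'a" where
  "expand q n x = (\<Sum>s\<in>I n. ((p s \<bullet> x) / (p s \<bullet> p s)) *\<^sub>R q s)"

text \<open>The conditions on target vectors under which \<open>p s \<mapsto> q s\<close> extends to a positive contraction: \<open>q\<close> is
  orthogonal like \<open>p\<close>, not larger than \<open>p\<close>, and satisfies the same linear relations between
  consecutive levels.\<close>

definition compatible :: "('i \<Rightarrow> 'a) \<Rightarrow> bool" where
  "compatible q \<longleftrightarrow> (\<forall>s. 0 \<le> q s) \<and> (\<forall>s. norm (q s) \<le> norm (p s)) \<and>
     (\<forall>n. \<forall>s\<in>I n. \<forall>t\<in>I n. s \<noteq> t \<longrightarrow> q s \<bullet> q t = 0) \<and>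
     (\<forall>n. \<forall>s\<in>I n. (\<Sum>t\<in>I (Suc n). ((p t \<bullet> p s) / (p t \<bullet> p t)) *\<^sub>R q t) = q s)"

lemma compatible_self: "compatible p"
  unfolding compatible_def using nonneg orth refine by auto

lemma linear_expand: "linear (expand q n)"
  by (rule linearI)
    (simp_all add: expand_def inner_add_right add_divide_distrib scaleR_add_left sum.distrib
      scaleR_sum_right)

lemma expand_same_level:
  assumes q: "compatible q" and s: "s \<in> I n"
  shows "expand q n (p s) = q s"
proof -
  have "expand q n (p s) = (\<Sum>t\<in>{s}. ((p t \<bullet> p s) / (p t \<bullet> p t)) *\<^sub>R q t)"
    unfolding expand_def using s orth by (intro sum.mono_neutral_right finite_level) auto
  also have "\<dots> = q s"
  proof (cases "p s = 0")
    case True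
    then have "q s = 0" using q unfolding compatible_def by (metis norm_le_zero_iff norm_zero)
    then show ?thesis by simp
  qed simp
  finally show ?thesis .
qed

lemma expand_Suc_expand:
  assumes q: "compatible q"
  shows "expand q (Suc n) (expand p n x) = expand q n x"
proof -
  have "expand q (Suc n) (p s) = q s" if "s \<in> I n" for s
    using q that by (simp add: compatible_def expand_def)
  then show ?thesis
    by (simp add: expand_def[of p] linear_sum[OF linear_expand] linear_cmul[OF linear_expand])
      (simp add: expand_def)
qed

lemma expand_p_later_level:
  assumes "s \<in> I n" "n \<le> m"
  shows "expand p m (p s) = p s"
  using assms(2)
proof (induction m rule: dec_induct)
  case base show ?case by (rule expand_same_level[OF compatible_self assms(1)])
next
  case (step m)
  show ?case using expand_Suc_expand[OF compatible_self, of m "p s"] step.IH by simp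
qed

lemma expand_later_level:
  assumes q: "compatible q" and s: "s \<in> I n" "n \<le> m"
  shows "expand q m (p s) = q s"
  using s(2)
proof (induction m rule: dec_induct)
  case base show ?case by (rule expand_same_level[OF q s(1)])
next
  case (step m)
  show ?case
    using expand_Suc_expand[OF q, of m "p s"] expand_p_later_level[OF s(1), of m] step by simp
qed

lemma expand_expand:
  assumes "compatible q" "n \<le> m"
  shows "expand q m (expand p n x) = expand q n x"
  using expand_later_level[OF assms(1) _ assms(2)]
  by (simp add: expand_def[of p] linear_sum[OF linear_expand] linear_cmul[OF linear_expand])
    (simp add: expand_def)

lemma norm_expand_power2:
  assumes "compatible q"
  shows "(norm (expand q n x))\<^sup>2 = (\<Sum>s\<in>I n. ((p s \<bullet> x) / (p s \<bullet> p s))\<^sup>2 * (norm (q s))\<^sup>2)"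
proof -
  have "(norm (expand q n x))\<^sup>2 =
      (\<Sum>s\<in>I n. (norm (((p s \<bullet> x) / (p s \<bullet> p s)) *\<^sub>R q s))\<^sup>2)"
    unfolding expand_def
    by (rule norm_sum_Pythagorean[OF finite_level])
      (use assms in \<open>auto simp: pairwise_def orthogonal_def compatible_def\<close>)
  then show ?thesis by (simp add: power_mult_distrib power_divide)
qed

lemma inner_expand: "expand p n x \<bullet> y = (\<Sum>s\<in>I n. (p s \<bullet> x) * (p s \<bullet> y) / (p s \<bullet> p s))"
  by (simp add: expand_def inner_sum_left)

lemma expand_symmetric: "expand p n x \<bullet> y = x \<bullet> expand p n y"
  by (subst inner_commute[of x]) (simp add: inner_expand mult.commute)

lemma norm_expand_self_le: "norm (expand p n x) \<le> norm x"
proof (cases "expand p n x = 0")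
  case False
  have "norm (expand p n x) * norm (expand p n x) = x \<bullet> expand p n x"
    using expand_expand[OF compatible_self order_refl, of n x]
    by (metis expand_symmetric power2_eq_square power2_norm_eq_inner)
  also have "\<dots> \<le> norm x * norm (expand p n x)" by (rule norm_cauchy_schwarz)
  finally show ?thesis using False by simp
qed simp

lemma norm_expand_le:
  assumes "compatible q"
  shows "norm (expand q n x) \<le> norm x"
proof -
  have "(norm (expand q n x))\<^sup>2 \<le> (norm (expand p n x))\<^sup>2"
    unfolding norm_expand_power2[OF assms] norm_expand_power2[OF compatible_self]
  proof (rule sum_mono)
    fix s
    have "norm (q s) \<le> norm (p s)" using assms by (simp add: compatible_def)
    then show "((p s \<bullet> x) / (p s \<bullet> p s))\<^sup>2 * (norm (q s))\<^sup>2 \<le> ((p s \<bullet> x) / (p s \<bullet> p s))\<^sup>2 * (norm (p s))\<^sup>2"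
      by (intro mult_left_mono power_mono) simp_all
  qed
  then have "norm (expand q n x) \<le> norm (expand p n x)" by (rule power2_le_imp_le) simp
  also have "\<dots> \<le> norm x" by (rule norm_expand_self_le)
  finally show ?thesis .
qed

text \<open>The projections onto increasing subspaces converge because the norms of \<open>expand p n x\<close> increase
  and their squares differ by the squared distances. The limit is \<open>x\<close> by totality.\<close>

lemma expand_tendsto: "(\<lambda>n. expand p n x) \<longlonglongrightarrow> x"
proof -
  have "convergent (\<lambda>n. expand p n x)"
  proof (rule convergent_if_norm_diff_power2_le)
    fix m n :: nat assume "n \<le> m"
    have "expand p m x \<bullet> expand p n x = x \<bullet> expand p n x"
      by (simp add: expand_symmetric expand_expand[OF compatible_self \<open>n \<le> m\<close>])
    moreover have "expand p n x \<bullet> expand p n x = x \<bullet> expand p n x"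
      by (simp add: expand_symmetric expand_expand[OF compatible_self order_refl])
    ultimately show "(norm (expand p m x - expand p n x))\<^sup>2
        \<le> (norm (expand p m x))\<^sup>2 - (norm (expand p n x))\<^sup>2"
      by (simp add: power2_norm_eq_inner inner_diff_left inner_diff_right inner_commute)
  next
    show "(norm (expand p n x))\<^sup>2 \<le> (norm x)\<^sup>2" for n
      by (intro power_mono norm_expand_self_le) simp
  qed
  then obtain z where z: "(\<lambda>n. expand p n x) \<longlonglongrightarrow> z" by (auto simp: convergent_def)
  have "p s \<bullet> (x - z) = 0" if s: "s \<in> I n" for n s
  proof -
    have "(\<lambda>m. p s \<bullet> expand p m x) \<longlonglongrightarrow> p s \<bullet> z" by (intro tendsto_intros z)
    moreover have "eventually (\<lambda>m. p s \<bullet> expand p m x = p s \<bullet> x) sequentially"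
      using eventually_ge_at_top[of n]
      by eventually_elim (simp add: expand_p_later_level[OF s] flip: expand_symmetric)
    ultimately have "(\<lambda>m. p s \<bullet> x) \<longlonglongrightarrow> p s \<bullet> z" by (rule Lim_transform_eventually)
    then have "p s \<bullet> x = p s \<bullet> z" by (simp add: LIMSEQ_const_iff)
    then show ?thesis by (simp add: inner_diff_right)
  qed
  then have "x - z = 0" by (rule total)
  with z show ?thesis by simp
qed

lemma expand_nonneg:
  assumes "compatible q" "0 \<le> x"
  shows "0 \<le> expand q n x"
  unfolding expand_def using assms nonneg
  by (intro sum_nonneg scaleR_nonneg_nonneg divide_nonneg_nonneg inner_nonneg) (auto simp: compatible_def)

text \<open>Beyond level \<open>n\<close>, the maps \<open>expand q m\<close> agree on the span of level \<open>n\<close>. They are contractions, so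
  \<open>expand q m x - expand q n x\<close> is bounded by the distance of \<open>x\<close> to that span, which tends to zero.\<close>

lemma extend_compatible:
  assumes q: "compatible q"
  obtains L where "bounded_linear L" "positive_operator L" "\<And>n s. s \<in> I n \<Longrightarrow> L (p s) = q s"
    "\<And>x. (\<lambda>n. expand q n x) \<longlonglongrightarrow> L x"
proof -
  have "convergent (\<lambda>n. expand q n x)" for x
  proof -
    have diff: "norm (expand q m x - expand q n x) \<le> norm (expand p n x - x)" if "n \<le> m" for m n
    proof -
      have "expand q m x - expand q n x = expand q m (x - expand p n x)"
        by (simp add: linear_diff[OF linear_expand] expand_expand[OF q that])
      then show ?thesis using norm_expand_le[OF q, of m "x - expand p n x"]
        by (simp add: norm_minus_commute)
    qed
    have "Cauchy (\<lambda>n. expand q n x)"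
    proof (rule metric_CauchyI)
      fix e :: real assume "0 < e"
      then obtain M where "\<And>n. M \<le> n \<Longrightarrow> norm (expand p n x - x) < e"
        using expand_tendsto[of x] unfolding LIMSEQ_iff by blast
      with diff have *: "dist (expand q m x) (expand q n x) < e" if "M \<le> n" "n \<le> m" for m n
        unfolding dist_norm using that by (blast intro: order_le_less_trans)
      have "dist (expand q m x) (expand q n x) < e" if "M \<le> m" "M \<le> n" for m n
        using *[of n m] *[of m n] that by (cases "n \<le> m") (simp_all add: dist_commute)
      then show "\<exists>M. \<forall>m\<ge>M. \<forall>n\<ge>M. dist (expand q m x) (expand q n x) < e" by blast
    qed
    then show ?thesis by (simp add: Cauchy_convergent)
  qed
  then obtain L where L: "bounded_linear L" "\<And>x. (\<lambda>n. expand q n x) \<longlonglongrightarrow> L x"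
    using strong_limit[of "expand q" 1, OF linear_expand] norm_expand_le[OF q] by auto
  have "positive_operator L"
    using L LIMSEQ_nonneg[OF L(2)] expand_nonneg[OF q]
    by (simp add: positive_operator_def bounded_linear.linear)
  moreover have "L (p s) = q s" if s: "s \<in> I n" for n s
  proof (rule LIMSEQ_unique[OF L(2)])
    have "eventually (\<lambda>m. q s = expand q m (p s)) sequentially"
      using eventually_ge_at_top[of n] by eventually_elim (simp add: expand_later_level[OF q s])
    then show "(\<lambda>m. expand q m (p s)) \<longlonglongrightarrow> q s"
      by (rule Lim_transform_eventually[OF tendsto_const])
  qed
  ultimately show thesis using that L by blast
qed

lemma extend_isometry:
  assumes q: "compatible q" and norm: "\<And>s. norm (q s) = norm (p s)"
  obtains L where "positive_operator L" "\<And>x y. L x \<bullet> L y = x \<bullet> y" "bounded_linear L"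
    "\<And>n s. s \<in> I n \<Longrightarrow> L (p s) = q s"
proof -
  obtain L where L: "bounded_linear L" "positive_operator L" "\<And>n s. s \<in> I n \<Longrightarrow> L (p s) = q s"
    "\<And>x. (\<lambda>n. expand q n x) \<longlonglongrightarrow> L x"
    using extend_compatible[OF q] by blast
  have lin: "linear L" using L(1) by (rule bounded_linear.linear)
  have normL: "L x \<bullet> L x = x \<bullet> x" for x
  proof -
    have eq: "(norm (expand q n x))\<^sup>2 = (norm (expand p n x))\<^sup>2" for n
      by (simp add: norm_expand_power2[OF q] norm_expand_power2[OF compatible_self] norm)
    have "(\<lambda>n. (norm (expand q n x))\<^sup>2) \<longlonglongrightarrow> (norm (L x))\<^sup>2" by (intro tendsto_intros L)
    moreover have "(\<lambda>n. (norm (expand q n x))\<^sup>2) \<longlonglongrightarrow> (norm x)\<^sup>2"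
      unfolding eq by (intro tendsto_intros expand_tendsto)
    ultimately show ?thesis by (simp add: LIMSEQ_unique flip: power2_norm_eq_inner)
  qed
  have "L x \<bullet> L y = x \<bullet> y" for x y
    using normL[of "x + y"] normL[of x] normL[of y]
    by (simp add: linear_add[OF lin] inner_add_left inner_add_right inner_commute)
  with that L show thesis by blast
qed

lemma eq_0_if_eq_0_on_system:
  assumes T: "bounded_linear T" and "\<And>n s. s \<in> I n \<Longrightarrow> T (p s) = 0"
  shows "T x = (0::'b::real_normed_vector)"
proof -
  have "T (expand p n x) = 0" for n
    using assms(2) bounded_linear.linear[OF T]
    by (simp add: expand_def linear_sum linear_cmul)
  with bounded_linear.tendsto[OF T expand_tendsto[of x]] show ?thesis
    by (simp add: LIMSEQ_const_iff)
qed

lemma positive_if_nonneg_on_system: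
  assumes T: "bounded_linear T" and "\<And>n s. s \<in> I n \<Longrightarrow> 0 \<le> T (p s)"
  shows "positive_operator T"
  unfolding positive_operator_def
proof (intro conjI allI impI)
  fix x :: 'a assume "0 \<le> x"
  then have "0 \<le> T (expand p n x)" for n
    using assms(2) nonneg bounded_linear.linear[OF T]
    by (simp add: expand_def linear_sum linear_cmul sum_nonneg scaleR_nonneg_nonneg inner_nonneg)
  then show "0 \<le> T x"
    by (rule LIMSEQ_nonneg[OF bounded_linear.tendsto[OF T expand_tendsto[of x]]])
qed (rule bounded_linear.linear[OF T])

lemma symmetric_if_symmetric_on_system:
  assumes T: "bounded_linear T"
    and sym: "\<And>n s t. s \<in> I n \<Longrightarrow> t \<in> I n \<Longrightarrow> T (p s) \<bullet> p t = p s \<bullet> T (p t)"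
  shows "T x \<bullet> y = x \<bullet> T y"
proof (rule LIMSEQ_unique)
  note lin = bounded_linear.linear[OF T]
  note lim = bounded_linear.tendsto[OF T expand_tendsto]
  show "(\<lambda>n. T (expand p n x) \<bullet> expand p n y) \<longlonglongrightarrow> T x \<bullet> y"
    by (intro tendsto_intros lim expand_tendsto)
  have "T (expand p n x) \<bullet> expand p n y = expand p n x \<bullet> T (expand p n y)" for n
    by (simp add: expand_def linear_sum[OF lin] linear_cmul[OF lin] inner_sum_left inner_sum_right sym)
  then show "(\<lambda>n. T (expand p n x) \<bullet> expand p n y) \<longlonglongrightarrow> x \<bullet> T y"
    by (simp only:) (intro tendsto_intros lim expand_tendsto)
qed

text \<open>A positive operator dominated by a multiple of the identity keeps disjoint elements disjoint, so
  on every level of the system its matrix is diagonal.\<close>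

lemma symmetric_if_dominated:
  fixes C :: "'a \<Rightarrow> 'a"
  assumes C: "positive_operator C" and r: "0 \<le> r" and le: "\<And>x. 0 \<le> x \<Longrightarrow> C x \<le> r *\<^sub>R x"
  shows "C x \<bullet> y = x \<bullet> C y"
proof -
  have lin: "linear C" using C by (simp add: positive_operator_def)
  have "norm (C x) \<le> r * norm x" for x by (rule norm_positive_operator_le[OF C le r])
  then have bl: "bounded_linear C"
    by (intro bounded_linear_intro[of C r] linear_add[OF lin] linear_cmul[OF lin])
      (simp add: mult.commute)
  have disj: "C x \<bullet> y = 0" if "x \<bullet> y = 0" "0 \<le> x" "0 \<le> y" for x y
  proof (rule inner_zero_mono)
    show "(r *\<^sub>R x) \<bullet> y = 0" using that by simp
    show "0 \<le> C x" using C that by (simp add: positive_operator_def)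
  qed (use that le in auto)
  show ?thesis
  proof (rule symmetric_if_symmetric_on_system[OF bl])
    fix n s t assume st: "s \<in> I n" "t \<in> I n"
    show "C (p s) \<bullet> p t = p s \<bullet> C (p t)"
    proof (cases "s = t")
      case False
      then show ?thesis
        using disj[OF orth[OF st False] nonneg nonneg] disj[OF orth[OF st(2,1)] nonneg nonneg]
        by (simp add: inner_commute)
    qed (simp add: inner_commute)
  qed
qed

end

section \<open>Components\<close>

text \<open>For \<open>0 \<le> p \<le> e\<close>, \<open>p \<bullet> (e - p) = 0\<close> is equivalent to the usual condition \<open>inf p (e - p) = 0\<close>. In
  this form it is visibly closed under limits, and the calculus of components reduces to monotonicity
  of the inner product.\<close>

definition component :: "'a::hilbert_lattice \<Rightarrow> 'a \<Rightarrow> bool" where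
  "component p e \<longleftrightarrow> 0 \<le> p \<and> p \<le> e \<and> p \<bullet> (e - p) = 0"

lemma componentD:
  assumes "component p e"
  shows "0 \<le> p" "p \<le> e" "p \<bullet> (e - p) = 0" "0 \<le> e"
  using assms order_trans[of 0 p e] by (simp_all add: component_def)

lemma component_refl: "0 \<le> e \<Longrightarrow> component e e"
  by (simp add: component_def)

lemma component_0: "0 \<le> e \<Longrightarrow> component 0 e"
  by (simp add: component_def)

lemma component_complement: "component p e \<Longrightarrow> component (e - p) e"
  by (simp add: component_def inner_commute)

lemma component_trans:
  assumes "component q p" "component p e"
  shows "component q e"
proof -
  have "q \<bullet> (e - p) = 0"
    using componentD[OF assms(1)] componentD[OF assms(2)]
    by (intro inner_zero_mono[of p "e - p" q "e - p"]) simp_all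
  moreover have "q \<bullet> (e - q) = q \<bullet> (e - p) + q \<bullet> (p - q)" by (simp add: inner_diff_right)
  ultimately show ?thesis
    using assms order_trans[of q p e] by (simp add: component_def)
qed

lemma component_of_smaller:
  assumes "component x e" "x \<le> a" "a \<le> e"
  shows "component x a"
  using assms inner_zero_mono[of x "e - x" x "a - x"] by (simp add: component_def)

lemma component_inf:
  assumes p: "component p e" and q: "component q e"
  shows "component (inf p q) e"
proof -
  have le: "e - inf p q \<le> (e - p) + (e - q)"
  proof -
    have "p + q - e \<le> p" "p + q - e \<le> q" using componentD[OF p] componentD[OF q]
      by (simp_all add: algebra_simps)
    then have "p + q - e \<le> inf p q" by simp
    then have "e - inf p q \<le> e - (p + q - e)" by (rule diff_left_mono)
    also have "\<dots> = (e - p) + (e - q)" by (simp add: algebra_simps)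
    finally show ?thesis .
  qed
  have 0: "0 \<le> inf p q" "inf p q \<le> e"
    using componentD[OF p] componentD[OF q] by (auto intro: le_infI1)
  from 0(2) have 1: "0 \<le> e - inf p q" by (simp only: diff_ge_0_iff_ge)
  have "inf p q \<bullet> (e - inf p q) \<le> inf p q \<bullet> ((e - p) + (e - q))"
    using inner_mono[OF le 0(1)] by (simp add: inner_commute)
  also have "\<dots> = 0"
    using inner_zero_mono[of p "e - p" "inf p q" "e - p"]
      inner_zero_mono[of q "e - q" "inf p q" "e - q"] componentD[OF p] componentD[OF q]
    by (simp add: inner_add_right)
  finally show ?thesis using 0 inner_nonneg[OF 0(1) 1] by (simp add: component_def)
qed

lemma component_inf_left:
  assumes "component p e" "component q e"
  shows "component (inf p q) p"
  using component_of_smaller[OF component_inf[OF assms], of p] componentD[OF assms(1)] by simp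

lemma component_add:
  assumes r: "component r q" and d: "component d (q - r)"
  shows "component (r + d) q"
proof -
  have "component (q - r - d) q"
    using component_trans[OF component_complement[OF d] component_complement[OF r]] .
  from component_complement[OF this] show ?thesis by (simp add: add.commute)
qed

lemma component_LIMSEQ:
  assumes X: "X \<longlonglongrightarrow> x" and c: "\<And>n. component (X n) e"
  shows "component x e"
proof -
  have "0 \<le> x" by (rule LIMSEQ_nonneg[OF X]) (use c in \<open>simp add: component_def\<close>)
  moreover have "(\<lambda>n. e - X n) \<longlonglongrightarrow> e - x" by (intro tendsto_intros X)
  from LIMSEQ_nonneg[OF this] have "x \<le> e" using c by (simp add: component_def)
  moreover have "(\<lambda>n. X n \<bullet> (e - X n)) \<longlonglongrightarrow> x \<bullet> (e - x)" by (intro tendsto_intros X)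
  then have "x \<bullet> (e - x) = 0" using c by (simp add: component_def LIMSEQ_const_iff)
  ultimately show ?thesis by (simp add: component_def)
qed

lemma norm_component_power2:
  assumes "component p e"
  shows "(norm e)\<^sup>2 = (norm p)\<^sup>2 + (norm (e - p))\<^sup>2"
  using assms
  by (simp add: component_def power2_norm_eq_inner inner_diff_left inner_diff_right inner_commute)

text \<open>Disjoint summands have their supremum as their sum, which gives one inequality. The other one
  comes from writing \<open>inf a c + inf b c\<close> as the infimum of the four sums.\<close>

lemma inf_add_disjoint:
  fixes a b c :: "'a::hilbert_lattice"
  assumes "0 \<le> a" "0 \<le> b" "0 \<le> c" "a \<bullet> b = 0"
  shows "inf (a + b) c = inf a c + inf b c"
proof (rule order.antisym)
  have "inf a c + inf b c = inf (inf (a + b) (a + c)) (inf (c + b) (c + c))"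
    by (simp add: add_inf_distrib_left add_inf_distrib_right inf_assoc inf_left_commute)
  moreover have "inf (a + b) c \<le> inf (inf (a + b) (a + c)) (inf (c + b) (c + c))"
    using assms by (auto intro: le_infI2)
  ultimately show "inf (a + b) c \<le> inf a c + inf b c" by simp
  have "inf (inf a c) (inf b c) = 0"
    using assms
    by (intro inf_eq_0_if_inner_eq_0 inner_zero_mono[of a b "inf a c" "inf b c"]) simp_all
  then have "inf a c + inf b c = sup (inf a c) (inf b c)"
    using add_eq_inf_sup[of "inf a c" "inf b c"] by simp
  also have "\<dots> \<le> c" by simp
  finally show "inf a c + inf b c \<le> inf (a + b) c" by (simp add: add_mono)
qed

text \<open>The part of \<open>e\<close> that lies in the band generated by \<open>z\<close> is the limit of the increasing sequence
  \<open>inf e (n z)\<close>. In a function space, it is \<open>e\<close> restricted to the support of \<open>z\<close>.\<close>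

lemma carrier_component:
  fixes e z :: "'a::hilbert_lattice"
  assumes e: "0 \<le> e" and z: "0 \<le> z"
  obtains p where "component p e" "inf e z \<le> p" "\<And>u. 0 \<le> u \<Longrightarrow> u \<bullet> z = 0 \<Longrightarrow> u \<bullet> p = 0"
proof -
  define X where "X n = inf e (real n *\<^sub>R z)" for n
  have nz: "0 \<le> real n *\<^sub>R z" for n using z by (simp add: scaleR_nonneg_nonneg)
  have X0: "0 \<le> X n" and Xe: "X n \<le> e" for n using e nz by (simp_all add: X_def)
  have Suc: "real (Suc n) *\<^sub>R z = real n *\<^sub>R z + z" for n by (simp add: scaleR_add_left)
  have mono: "X n \<le> X (Suc n)" for n
    unfolding X_def Suc using z by (intro inf_mono order_refl) simp
  have bound: "norm (X n) \<le> norm e" for n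
    using X0 Xe e by (intro norm_lattice) simp
  obtain p where p: "X \<longlonglongrightarrow> p" "\<And>n. X n \<le> p"
    using increasing_bounded_convergent[of X, OF mono X0 bound] by blast
  have p0: "0 \<le> p" by (rule order_trans[OF X0[of 0] p(2)])
  have "(\<lambda>n. e - X n) \<longlonglongrightarrow> e - p" by (intro tendsto_intros p)
  from LIMSEQ_nonneg[OF this] have pe: "p \<le> e" using Xe by simp
  \<comment> \<open>Adding a common minorant \<open>v\<close> of \<open>e - p\<close> and \<open>z\<close> to \<open>X n\<close> stays below \<open>X (Suc n)\<close>, hence below
    \<open>p\<close>. In the limit this forces \<open>v = 0\<close>.\<close>
  define v where "v = inf (e - p) z"
  have v: "0 \<le> v" "v \<le> e - p" "v \<le> z" using z pe by (simp_all add: v_def)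
  have Xv: "X n + v \<le> p" for n
  proof -
    have "X n + v \<le> p + (e - p)" using p(2) v(2) by (rule add_mono)
    moreover have "X n + v \<le> real n *\<^sub>R z + z" using v(3) by (intro add_mono) (simp_all add: X_def)
    ultimately have "X n + v \<le> X (Suc n)" unfolding X_def[of "Suc n"] Suc by simp
    then show ?thesis using p(2) order_trans by blast
  qed
  have "(\<lambda>n. p - (X n + v)) \<longlonglongrightarrow> p - (p + v)" by (intro tendsto_intros p)
  from LIMSEQ_nonneg[OF this] have "0 \<le> p - (p + v)" using Xv by simp
  then have "v = 0" using v(1) by simp
  then have ez: "(e - p) \<bullet> z = 0" unfolding v_def by (rule inner_eq_0_if_inf_eq_0)
  have disj: "u \<bullet> p = 0" if u: "0 \<le> u" "u \<bullet> z = 0" for u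
  proof -
    have "u \<bullet> X n = 0" for n
      using u nz X0 by (intro inner_zero_mono[of u "real n *\<^sub>R z" u "X n"]) (simp_all add: X_def)
    moreover have "(\<lambda>n. u \<bullet> X n) \<longlonglongrightarrow> u \<bullet> p" by (intro tendsto_intros p)
    ultimately show ?thesis by (simp add: LIMSEQ_const_iff)
  qed
  have "component p e"
    using disj[OF _ ez] p0 pe by (simp add: component_def inner_commute)
  moreover have "inf e z \<le> p" using p(2)[of 1] by (simp add: X_def)
  ultimately show thesis using that disj by blast
qed

definition weak_unit :: "'a::hilbert_lattice \<Rightarrow> bool" where
  "weak_unit e \<longleftrightarrow> 0 \<le> e \<and> (\<forall>y\<ge>0. y \<bullet> e = 0 \<longrightarrow> y = 0)"

lemma carrier_component_nonzero:
  fixes z :: "'a::hilbert_lattice"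
  assumes e: "weak_unit e" and z: "0 \<le> z" "z \<noteq> 0"
    and p: "inf e z \<le> p" "component p e"
  shows "z \<bullet> p \<noteq> 0"
proof
  assume "z \<bullet> p = 0"
  then have "z \<bullet> inf e z = 0"
    using p z e by (intro inner_zero_mono[of z p z "inf e z"]) (simp_all add: weak_unit_def)
  then have "inf e z \<bullet> inf e z = 0"
    using z e inner_zero_mono[of z "inf e z" "inf e z" "inf e z"] by (simp add: weak_unit_def)
  then have "inf z e = 0" by (simp add: inf_commute)
  then have "z \<bullet> e = 0" by (rule inner_eq_0_if_inf_eq_0)
  then show False using e z by (simp add: weak_unit_def)
qed

text \<open>If the positive part of \<open>y\<close> were nonzero, some \<open>a\<close> in \<open>F\<close> would lie under its carrier component.
  Such an \<open>a\<close> is disjoint from the negative part, so \<open>a \<bullet> y = 0\<close> makes it disjoint from the positive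
  part too, which contradicts the choice of the carrier. This is applied to the set of all components
  and to the set of atoms; it takes the place of a density theorem for step functions.\<close>

lemma eq_0_if_orthogonal_to_small_elements:
  assumes e: "weak_unit e" and orth: "\<And>a. a \<in> F \<Longrightarrow> a \<bullet> y = 0"
    and small: "\<And>p. component p e \<Longrightarrow> p \<noteq> 0 \<Longrightarrow> \<exists>a\<in>F. 0 \<le> a \<and> a \<le> p \<and> a \<noteq> 0"
  shows "y = 0"
proof -
  have *: "pprt y = 0" if orth: "\<And>a. a \<in> F \<Longrightarrow> a \<bullet> y = 0" for y :: 'a
  proof (rule ccontr)
    assume ne: "pprt y \<noteq> 0"
    have e0: "0 \<le> e" using e by (simp add: weak_unit_def)
    obtain p where p: "component p e" "inf e (pprt y) \<le> p"
      "\<And>u. 0 \<le> u \<Longrightarrow> u \<bullet> pprt y = 0 \<Longrightarrow> u \<bullet> p = 0"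
      using carrier_component[OF e0 zero_le_pprt[of y]] by blast
    have "p \<noteq> 0" using carrier_component_nonzero[OF e _ ne p(2,1)] by auto
    then obtain a where a: "a \<in> F" "0 \<le> a" "a \<le> p" "a \<noteq> 0" using small[OF p(1)] by blast
    have "p \<bullet> pprt (- y) = 0"
      using p(3)[of "pprt (- y)"] inner_pprt_pprt_uminus[of y] by (simp add: inner_commute)
    then have "a \<bullet> pprt (- y) = 0"
      by (rule inner_zero_mono) (simp_all add: a)
    moreover have "a \<bullet> y = a \<bullet> pprt y - a \<bullet> pprt (- y)"
      by (subst pprt_diff_pprt_uminus[of y]) (rule inner_diff_right)
    ultimately have "a \<bullet> pprt y = 0" using orth[OF a(1)] by simp
    then have "a \<bullet> p = 0" by (rule p(3)[OF a(2)])
    then have "a \<bullet> a = 0" by (rule inner_zero_mono) (simp_all add: a)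
    with a(4) show False by simp
  qed
  have "pprt y = 0" "pprt (- y) = 0" using orth by (auto intro: *)
  then show ?thesis using pprt_diff_pprt_uminus[of y] by simp
qed

lemma eq_0_if_orthogonal_to_components:
  assumes e: "weak_unit e" and orth: "\<And>p. component p e \<Longrightarrow> p \<bullet> y = 0"
  shows "y = 0"
  by (rule eq_0_if_orthogonal_to_small_elements[OF e, of "{p. component p e}"])
    (auto simp: orth intro: componentD(1))

section \<open>Separability\<close>

text \<open>Subsets of a separable metric space are separable: choose a point of \<open>K\<close> within distance \<open>1/(n+1)\<close>
  of \<open>d\<close>, if there is one, for each \<open>d\<close> in a countable dense set and each \<open>n\<close>.\<close>

lemma dense_sequence:
  fixes K :: "'a::metric_space set"
  assumes sep: "separable_space (euclidean :: 'a topology)" and K: "K \<noteq> {}"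
  obtains c :: "nat \<Rightarrow> 'a" where "range c \<subseteq> K" "K \<subseteq> closure (range c)"
proof -
  obtain D :: "'a set" where D: "countable D" "closure D = UNIV"
    using sep by (auto simp: separable_space_def)
  obtain k0 where k0: "k0 \<in> K" using K by blast
  define g where "g dn = (if \<exists>x\<in>K. dist (fst dn) x < 1 / real (Suc (snd dn))
      then SOME x. x \<in> K \<and> dist (fst dn) x < 1 / real (Suc (snd dn)) else k0)" for dn :: "'a \<times> nat"
  have g: "g (d, n) \<in> K \<and> dist d (g (d, n)) < 1 / real (Suc n)"
    if "x \<in> K" "dist d x < 1 / real (Suc n)" for d n x
  proof -
    have "\<exists>x. x \<in> K \<and> dist d x < 1 / real (Suc n)" using that by blast
    from someI_ex[OF this] show ?thesis using that by (auto simp: g_def)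
  qed
  have gK: "g dn \<in> K" for dn
    using g[of _ "fst dn" "snd dn"] k0 by (cases "\<exists>x\<in>K. dist (fst dn) x < 1 / real (Suc (snd dn))")
      (auto simp: g_def)
  define G where "G = g ` (D \<times> UNIV)"
  have "countable G" using D(1) by (simp add: G_def)
  moreover have "D \<noteq> {}" using D(2) by auto
  then have "G \<noteq> {}" by (simp add: G_def)
  ultimately have ran: "range (from_nat_into G) = G" by (simp add: range_from_nat_into)
  have "K \<subseteq> closure G"
  proof
    fix x assume x: "x \<in> K"
    show "x \<in> closure G"
      unfolding closure_approachable
    proof (intro allI impI)
      fix r :: real assume "0 < r"
      then obtain n where n: "1 / real (Suc n) < r / 2" using nat_approx_posE[of "r / 2"] by auto
      obtain d where d: "d \<in> D" "dist d x < 1 / real (Suc n)"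
        using D(2) closure_approachable[of x D] by (auto dest: spec[of _ "1 / real (Suc n)"])
      have "dist (g (d, n)) x \<le> dist d (g (d, n)) + dist d x" by (metis dist_commute dist_triangle)
      then have "dist (g (d, n)) x < r" using g[OF x d(2)] d(2) n by argo
      moreover have "g (d, n) \<in> G" using d(1) by (simp add: G_def)
      ultimately show "\<exists>y\<in>G. dist y x < r" by blast
    qed
  qed
  moreover have "G \<subseteq> K" using gK by (auto simp: G_def)
  ultimately show thesis using that[of "from_nat_into G"] ran by simp
qed

lemma inner_eq_0_on_closure:
  fixes y :: "'a::real_inner"
  assumes "\<And>n. c n \<bullet> y = 0" "x \<in> closure (range c)"
  shows "x \<bullet> y = 0"
proof -
  have "closed {x. y \<bullet> x = 0}" by (rule closed_hyperplane)
  then have "closure (range c) \<subseteq> {x. y \<bullet> x = 0}"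
    using assms(1) by (intro closure_minimal) (auto simp: inner_commute)
  then show ?thesis using assms(2) by (auto simp: inner_commute)
qed

text \<open>Take a convergent combination, with positive coefficients, of the moduli of a dense sequence. An
  element of the cone orthogonal to it is orthogonal to the whole sequence, hence to itself.\<close>

lemma weak_unit_exists:
  assumes sep: "separable_space (euclidean :: 'a::hilbert_lattice topology)"
  obtains e :: "'a::hilbert_lattice" where "weak_unit e"
proof -
  obtain d :: "nat \<Rightarrow> 'a" where d: "UNIV \<subseteq> closure (range d)" by (rule dense_sequence[OF sep UNIV_not_empty])
  define f where "f n = ((1/2)^n / (1 + norm (d n))) *\<^sub>R \<bar>d n\<bar>" for n
  have f0: "0 \<le> f n" for n by (simp add: f_def scaleR_nonneg_nonneg)
  have fn: "norm (f n) \<le> (1/2)^n" for n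
  proof -
    have "norm \<bar>d n\<bar> \<le> 1 + norm (d n)" using norm_lattice[of "\<bar>d n\<bar>" "d n"] by simp
    then have "norm \<bar>d n\<bar> / (1 + norm (d n)) \<le> 1" by (simp add: divide_le_eq add_pos_nonneg)
    then have "(1/2)^n * (norm \<bar>d n\<bar> / (1 + norm (d n))) \<le> (1/2)^n * 1" by (intro mult_left_mono) simp_all
    then show ?thesis by (simp add: f_def add_nonneg_nonneg)
  qed
  have "summable (\<lambda>n. (1/2::real)^n)" by (rule summable_geometric) simp
  then have sm: "summable f" by (rule summable_comparison_test'[OF _ fn])
  define e where "e = suminf f"
  have fe: "f n \<le> e" for n
  proof -
    have "(\<lambda>m. sum f {..<m + Suc n} - f n) \<longlonglongrightarrow> e - f n"
      unfolding e_def by (intro tendsto_intros LIMSEQ_ignore_initial_segment summable_LIMSEQ sm)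
    moreover have "0 \<le> sum f {..<m + Suc n} - f n" for m
    proof -
      have "sum f {n} \<le> sum f {..<m + Suc n}" by (intro sum_mono2) (auto simp: f0)
      then show ?thesis by simp
    qed
    ultimately have "0 \<le> e - f n" by (rule LIMSEQ_nonneg)
    then show ?thesis by simp
  qed
  have e0: "0 \<le> e" using order_trans[OF f0 fe] .
  have "y = 0" if y: "0 \<le> y" "y \<bullet> e = 0" for y
  proof -
    have "d n \<bullet> y = 0" for n
    proof -
      have "y \<bullet> f n = 0" using inner_zero_mono[OF y(2) y(1) order_refl f0 fe] .
      then have "((1/2)^n / (1 + norm (d n))) * (y \<bullet> \<bar>d n\<bar>) = 0" by (simp add: f_def)
      then have "y \<bullet> \<bar>d n\<bar> = 0"
        using add_pos_nonneg[of 1 "norm (d n)"] by simp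
      moreover have "d n \<bullet> y \<le> \<bar>d n\<bar> \<bullet> y" "(- d n) \<bullet> y \<le> \<bar>d n\<bar> \<bullet> y"
        by (intro inner_mono y abs_ge_self abs_ge_minus_self)+
      ultimately show ?thesis by (simp add: inner_commute)
    qed
    then have "y \<bullet> y = 0" using inner_eq_0_on_closure[of d y y] d by auto
    then show ?thesis by simp
  qed
  then show thesis using that e0 unfolding weak_unit_def by blast
qed

section \<open>Binary trees of components\<close>

text \<open>Nodes are addressed by their path from the root, last decision first.\<close>

definition level :: "nat \<Rightarrow> bool list set" where
  "level n = {s. length s = n}"

definition splitting :: "(bool list \<Rightarrow> 'a::hilbert_lattice) \<Rightarrow> bool" where
  "splitting q \<longleftrightarrow> (\<forall>s. 0 \<le> q s \<and> q s = q (True # s) + q (False # s) \<and>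
     q (True # s) \<bullet> q (False # s) = 0)"

lemma splittingD:
  assumes "splitting q"
  shows "0 \<le> q s" "q (True # s) + q (False # s) = q s" "q (True # s) \<bullet> q (False # s) = 0"
proof -
  have *: "0 \<le> q s \<and> q s = q (True # s) + q (False # s) \<and> q (True # s) \<bullet> q (False # s) = 0"
    using assms unfolding splitting_def by (rule spec)
  show "0 \<le> q s" using * by (rule conjunct1)
  show "q (True # s) + q (False # s) = q s" using * by (elim conjE) (rule sym)
  show "q (True # s) \<bullet> q (False # s) = 0" using * by (elim conjE)
qed

lemma finite_level: "finite (level n)"
  using finite_lists_length_eq[of "UNIV :: bool set" n] by (simp add: level_def)

lemma level_0: "level 0 = {[]}"
  by (auto simp: level_def)

lemma sum_level_Suc: "sum f (level (Suc n)) = (\<Sum>s\<in>level n. f (True # s) + f (False # s))"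
proof -
  have "level (Suc n) = (Cons True) ` level n \<union> (Cons False) ` level n"
    by (auto simp: level_def length_Suc_conv)
  moreover have "(Cons True) ` level n \<inter> (Cons False) ` level n = {}" by auto
  ultimately have "sum f (level (Suc n)) = sum f ((Cons True) ` level n) + sum f ((Cons False) ` level n)"
    by (simp only: sum.union_disjoint finite_level finite_imageI)
  then show ?thesis by (simp add: sum.reindex sum.distrib)
qed

lemma splitting_child_le:
  assumes "splitting q"
  shows "q (b # s) \<le> q s"
proof -
  have "q s - q (b # s) = q ((\<not> b) # s)" using splittingD(2)[OF assms, of s] by (cases b) (simp_all add: diff_eq_eq add.commute)
  then show ?thesis using splittingD(1)[OF assms, of "(\<not> b) # s"] by (metis diff_ge_0_iff_ge)
qed

lemma splitting_orthogonal:
  assumes q: "splitting q" and "s \<in> level n" "t \<in> level n" "s \<noteq> t"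
  shows "q s \<bullet> q t = 0"
  using assms(2-)
proof (induction n arbitrary: s t)
  case 0 then show ?case by (simp add: level_def)
next
  case (Suc n)
  obtain b s' where s: "s = b # s'" "s' \<in> level n" using Suc.prems(1) by (cases s) (auto simp: level_def)
  obtain b' t' where t: "t = b' # t'" "t' \<in> level n" using Suc.prems(2) by (cases t) (auto simp: level_def)
  show ?case
  proof (cases "s' = t'")
    case True
    with Suc.prems(3) s t have "b' = (\<not> b)" by auto
    with s t True show ?thesis
      using splittingD(3)[OF q, of t'] by (cases b) (simp_all add: inner_commute)
  next
    case False
    show ?thesis unfolding s(1) t(1)
      by (rule inner_zero_mono[OF Suc.IH[OF s(2) t(2) False]])
        (simp_all add: splittingD(1)[OF q] splitting_child_le[OF q])
  qed
qed

text \<open>The coefficient of \<open>p t\<close> in \<open>p s\<close> is \<open>1\<close> if \<open>t\<close> is a child of \<open>s\<close> and \<open>0\<close> otherwise. The exception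
  is a child with \<open>p t = 0\<close>, where the coefficient is \<open>0 / 0 = 0\<close>; the norm bound then gives \<open>q t = 0\<close>.\<close>

lemma splitting_refine:
  assumes p: "splitting p" and q: "splitting q" and le: "\<And>s. norm (q s) \<le> norm (p s)"
    and s: "s \<in> level n"
  shows "(\<Sum>t\<in>level (Suc n). ((p t \<bullet> p s) / (p t \<bullet> p t)) *\<^sub>R q t) = q s"
proof -
  have coeff: "((p (b # t) \<bullet> p s) / (p (b # t) \<bullet> p (b # t))) *\<^sub>R q (b # t) = (if t = s then q (b # t) else 0)"
    if t: "t \<in> level n" for b t
  proof (cases "t = s")
    case False
    have "p (b # t) \<bullet> p s = 0"
      by (rule inner_zero_mono[OF splitting_orthogonal[OF p t s False]])
        (simp_all add: splittingD(1)[OF p] splitting_child_le[OF p])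
    then show ?thesis using False by simp
  next
    case True
    show ?thesis
    proof (cases "p (b # t) = 0")
      case 1: True
      then have "q (b # t) = 0" using le[of "b # t"] by simp
      then show ?thesis by auto
    next
      case False
      have "p (b # t) \<bullet> p ((\<not> b) # t) = 0"
        using splittingD(3)[OF p, of t] by (cases b) (simp_all add: inner_commute)
      moreover have "p t = p (b # t) + p ((\<not> b) # t)"
        using splittingD(2)[OF p, of t] by (cases b) (simp_all add: add.commute)
      ultimately have "p (b # t) \<bullet> p t = p (b # t) \<bullet> p (b # t)" by (simp add: inner_add_right)
      then show ?thesis using False True by simp
    qed
  qed
  have "(\<Sum>t\<in>level (Suc n). ((p t \<bullet> p s) / (p t \<bullet> p t)) *\<^sub>R q t)
      = (\<Sum>t\<in>level n. if t = s then q (True # t) + q (False # t) else 0)"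
    unfolding sum_level_Suc by (intro sum.cong refl) (simp add: coeff)
  also have "\<dots> = q s" using s finite_level splittingD(2)[OF q] by simp
  finally show ?thesis .
qed

lemma splitting_compatible:
  assumes "refining_system p level" "splitting p" "splitting q" "\<And>s. norm (q s) \<le> norm (p s)"
  shows "refining_system.compatible p level q"
proof -
  interpret refining_system p level by fact
  show ?thesis unfolding compatible_def
    using assms splittingD(1)[OF assms(3)] splitting_orthogonal[OF assms(3)]
      splitting_refine[OF assms(2-4)] by blast
qed

text \<open>\<open>f s a\<close> is the part of the node \<open>a\<close> at address \<open>s\<close> that goes to its \<open>True\<close> child.\<close>

primrec split_tree :: "(bool list \<Rightarrow> 'a::hilbert_lattice \<Rightarrow> 'a) \<Rightarrow> 'a \<Rightarrow> bool list \<Rightarrow> 'a" where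
  "split_tree f w [] = w"
| "split_tree f w (b # s) = (if b then f s (split_tree f w s) else split_tree f w s - f s (split_tree f w s))"

lemma splitting_split_tree:
  assumes "\<And>s. component (split_tree f w s) e" "\<And>s. component (f s (split_tree f w s)) (split_tree f w s)"
  shows "splitting (split_tree f w)"
  using assms by (auto simp: splitting_def component_def)

lemma splitting_inf:
  assumes p: "splitting p" and c: "0 \<le> c"
  shows "splitting (\<lambda>s. inf (p s) c)"
  unfolding splitting_def
proof (intro allI conjI)
  fix s
  note p0 = splittingD(1)[OF p] and ps = splittingD(2)[OF p] and pd = splittingD(3)[OF p]
  show "0 \<le> inf (p s) c" using p0 c by simp
  show "inf (p s) c = inf (p (True # s)) c + inf (p (False # s)) c"
    using inf_add_disjoint[OF p0 p0 c pd, of s] by (simp add: ps)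
  show "inf (p (True # s)) c \<bullet> inf (p (False # s)) c = 0"
    by (rule inner_zero_mono[OF pd[of s]]) (simp_all add: p0 c)
qed

lemma splitting_sum_level:
  assumes "splitting q"
  shows "sum q (level n) = q []"
  by (induction n) (simp_all add: level_0 sum_level_Suc splittingD(2)[OF assms])

text \<open>The nodes at depth \<open>n\<close> are cut along the \<open>n\<close>-th member \<open>c n\<close> of a dense sequence of components.
  Every \<open>c n\<close> is then a sum of nodes, so an element orthogonal to all nodes is orthogonal to all
  components and vanishes.\<close>

lemma component_tree_exists:
  assumes sep: "separable_space (euclidean :: 'a::hilbert_lattice topology)"
    and e: "weak_unit (e::'a::hilbert_lattice)"
  obtains p where "refining_system p level" "splitting p" "p [] = e" "\<And>s. component (p s) e"
proof -
  have e0: "0 \<le> e" using e by (simp add: weak_unit_def)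
  have "{p. component p e} \<noteq> {}" using component_0[OF e0] by blast
  then obtain c :: "nat \<Rightarrow> 'a" where c': "range c \<subseteq> {p. component p e}" "{p. component p e} \<subseteq> closure (range c)"
    by (rule dense_sequence[OF sep])
  have c: "component (c n) e" for n using c'(1) by auto
  define p where "p = split_tree (\<lambda>s a. inf a (c (length s))) e"
  have pS: "p (True # s) = inf (p s) (c (length s))" "p (False # s) = p s - inf (p s) (c (length s))" for s
    by (simp_all add: p_def)
  have comp: "component (p s) e" for s
  proof (induction s)
    case Nil show ?case using component_refl[OF e0] by (simp add: p_def)
  next
    case (Cons b s)
    note 1 = component_inf[OF Cons c] and 2 = component_inf_left[OF Cons c]
    show ?case
      using 1 component_trans[OF component_complement[OF 2] Cons] by (cases b) (simp_all add: pS)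
  qed
  have split: "splitting p"
    unfolding p_def
  proof (rule splitting_split_tree)
    fix s
    show "component (split_tree (\<lambda>s a. inf a (c (length s))) e s) e" using comp by (simp add: p_def)
    show "component (inf (split_tree (\<lambda>s a. inf a (c (length s))) e s) (c (length s)))
        (split_tree (\<lambda>s a. inf a (c (length s))) e s)"
      using component_inf_left[OF comp c] by (simp add: p_def)
  qed
  have "refining_system p level"
  proof
    show "finite (level n)" for n by (rule finite_level)
    show "0 \<le> p s" for s using comp by (rule componentD)
    show "p s \<bullet> p t = 0" if "s \<in> level n" "t \<in> level n" "s \<noteq> t" for s t n
      using splitting_orthogonal[OF split that] .
    show "(\<Sum>t\<in>level (Suc n). ((p t \<bullet> p s) / (p t \<bullet> p t)) *\<^sub>R p t) = p s" if "s \<in> level n" for n s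
      using splitting_refine[OF split split order_refl that] .
    fix x assume orth: "\<And>n s. s \<in> level n \<Longrightarrow> p s \<bullet> x = 0"
    have p0: "p s \<bullet> x = 0" for s using orth[of s "length s"] by (simp add: level_def)
    have "c n \<bullet> x = 0" for n
    proof -
      have "(\<Sum>s\<in>level n. inf (p s) (c n)) = inf (p []) (c n)"
        by (rule splitting_sum_level[OF splitting_inf[OF split]]) (rule componentD(1)[OF c])
      also have "\<dots> = c n" using componentD(2)[OF c] by (simp add: p_def inf_absorb2)
      finally have "c n = (\<Sum>s\<in>level n. p (True # s))" by (simp add: pS level_def)
      then show ?thesis by (simp add: inner_sum_left p0)
    qed
    then have "q \<bullet> x = 0" if "component q e" for q
      using inner_eq_0_on_closure[of c x q] c'(2) that by blast
    then show "x = 0" by (rule eq_0_if_orthogonal_to_components[OF e])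
  qed
  with that split comp show thesis by (simp add: p_def)
qed

section \<open>Nonatomic components\<close>

definition atom :: "'a::hilbert_lattice \<Rightarrow> bool" where
  "atom a \<longleftrightarrow> a \<noteq> 0 \<and> (\<forall>x. component x a \<longrightarrow> x = 0 \<or> x = a)"

text \<open>A nonzero component that is not an atom splits properly, and the smaller of the two parts has at most half
  of the squared norm.\<close>

lemma small_component_exists:
  fixes a w :: "'a::hilbert_lattice"
  assumes nonatomic: "\<And>a. component a w \<Longrightarrow> \<not> atom a"
    and a: "component a w" "a \<noteq> 0" and \<epsilon>: "0 < (\<epsilon>::real)"
  obtains d where "component d a" "d \<noteq> 0" "(norm d)\<^sup>2 < \<epsilon>"
proof -
  have "\<exists>d. component d a \<and> d \<noteq> 0 \<and> (norm d)\<^sup>2 \<le> (norm a)\<^sup>2 * (1/2)^n" for n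
  proof (induction n)
    case 0 show ?case using component_refl[OF componentD(1)[OF a(1)]] a(2) by auto
  next
    case (Suc n)
    then obtain d where d: "component d a" "d \<noteq> 0" "(norm d)\<^sup>2 \<le> (norm a)\<^sup>2 * (1/2)^n" by blast
    have "\<not> atom d" by (rule nonatomic[OF component_trans[OF d(1) a(1)]])
    then obtain x where x: "component x d" "x \<noteq> 0" "x \<noteq> d" using d(2) by (auto simp: atom_def)
    define y where "y = (if norm x \<le> norm (d - x) then x else d - x)"
    have y: "component y d" "y \<noteq> 0" using x component_complement[OF x(1)] by (auto simp: y_def)
    have "norm y \<le> norm x" "norm y \<le> norm (d - x)" by (simp_all add: y_def)
    then have "(norm y)\<^sup>2 \<le> (norm x)\<^sup>2" "(norm y)\<^sup>2 \<le> (norm (d - x))\<^sup>2" by (simp_all add: power_mono)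
    then have "2 * (norm y)\<^sup>2 \<le> (norm d)\<^sup>2" using norm_component_power2[OF x(1)] by linarith
    then have "(norm y)\<^sup>2 \<le> (norm a)\<^sup>2 * (1/2)^Suc n" using d(3) by simp
    with y component_trans[OF y(1) d(1)] show ?case by blast
  qed
  then obtain X where X: "\<And>n. component (X n) a" "\<And>n. X n \<noteq> 0"
    "\<And>n. (norm (X n))\<^sup>2 \<le> (norm a)\<^sup>2 * (1/2)^n" by metis
  have "(\<lambda>n. (norm a)\<^sup>2 * (1/2::real)^n) \<longlonglongrightarrow> (norm a)\<^sup>2 * 0"
    by (intro tendsto_intros LIMSEQ_power_zero) simp
  then have "eventually (\<lambda>n. (norm a)\<^sup>2 * (1/2::real)^n < \<epsilon>) sequentially"
    using \<epsilon> by (intro order_tendstoD(2)) simp_all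
  then obtain n where "(norm a)\<^sup>2 * (1/2::real)^n < \<epsilon>" by (auto simp: eventually_sequentially)
  with X(3)[of n] have "(norm (X n))\<^sup>2 < \<epsilon>" by linarith
  with that X show thesis by blast
qed

lemma norm_disjoint_sum_power2:
  assumes x: "component x q" and d: "component d (q - x)"
  shows "(norm (x + d))\<^sup>2 = (norm x)\<^sup>2 + (norm d)\<^sup>2"
proof -
  have "x \<bullet> d = 0"
    by (rule inner_zero_mono[OF componentD(3)[OF x]])
      (simp_all add: componentD[OF d] componentD[OF x])
  then show ?thesis
    by (simp add: power2_norm_eq_inner inner_add_left inner_add_right inner_commute)
qed

text \<open>Sierpinski's theorem on nonatomic measures, by greedy exhaustion. Starting from \<open>0\<close>, one keeps
  adding an admissible piece, that is, a component of the rest that does not exceed the target \<open>b\<close>,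
  whose squared norm is at least half of what is possible. If the limit fell short of \<open>b\<close>, a small
  component of the remainder would have been admissible all along.\<close>

lemma component_of_prescribed_norm:
  fixes q w :: "'a::hilbert_lattice"
  assumes nonatomic: "\<And>a. component a w \<Longrightarrow> \<not> atom a" and q: "component q w"
    and b: "0 \<le> b" "b \<le> (norm q)\<^sup>2"
  obtains r where "component r q" "(norm r)\<^sup>2 = b"
proof -
  define adm where "adm x d \<longleftrightarrow> component d (q - x) \<and> (norm d)\<^sup>2 \<le> b - (norm x)\<^sup>2" for x d
  have "\<exists>d. adm x d \<and> (\<forall>d'. adm x d' \<longrightarrow> (norm d')\<^sup>2 \<le> 2 * (norm d)\<^sup>2)"
    if x: "component x q" "(norm x)\<^sup>2 \<le> b" for x
  proof -
    define N where "N = {(norm d)\<^sup>2 |d. adm x d}"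
    have "adm x 0" using x by (simp add: adm_def component_0 componentD)
    then have ne: "N \<noteq> {}" by (auto simp: N_def)
    have bdd: "bdd_above N" by (rule bdd_aboveI[of _ "b - (norm x)\<^sup>2"]) (auto simp: N_def adm_def)
    have le: "(norm d')\<^sup>2 \<le> Sup N" if "adm x d'" for d'
      by (rule cSup_upper[OF _ bdd]) (use that in \<open>auto simp: N_def\<close>)
    have "\<exists>d. adm x d \<and> Sup N \<le> 2 * (norm d)\<^sup>2"
    proof (cases "0 < Sup N")
      case True
      then have "Sup N / 2 < Sup N" by simp
      then obtain m where "m \<in> N" "Sup N / 2 < m" using less_cSupE[OF _ ne] by blast
      then show ?thesis by (auto simp: N_def)
    next
      case False
      then show ?thesis using \<open>adm x 0\<close> by auto
    qed
    with le show ?thesis by (meson order_trans)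
  qed
  then obtain f where f: "\<And>x. component x q \<Longrightarrow> (norm x)\<^sup>2 \<le> b \<Longrightarrow> adm x (f x)"
    "\<And>x d'. component x q \<Longrightarrow> (norm x)\<^sup>2 \<le> b \<Longrightarrow> adm x d' \<Longrightarrow> (norm d')\<^sup>2 \<le> 2 * (norm (f x))\<^sup>2"
    by metis
  define X where "X = rec_nat 0 (\<lambda>n x. x + f x)"
  have X0: "X 0 = 0" and XS: "X (Suc n) = X n + f (X n)" for n by (simp_all add: X_def)
  have X: "component (X n) q \<and> (norm (X n))\<^sup>2 \<le> b" for n
  proof (induction n)
    case 0 show ?case using component_0[OF componentD(1)[OF q]] b by (simp add: X0)
  next
    case (Suc n)
    then have "adm (X n) (f (X n))" using f(1) by blast
    then show ?case unfolding XS
      using Suc component_add[of "X n" q "f (X n)"] norm_disjoint_sum_power2[of "X n" q "f (X n)"]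
      by (auto simp: adm_def)
  qed
  then have Xc: "component (X n) q" and Xb: "(norm (X n))\<^sup>2 \<le> b" for n by auto
  have adm: "adm (X n) (f (X n))" for n using f(1)[OF Xc Xb] .
  have step: "(norm (f (X n)))\<^sup>2 = (norm (X (Suc n)))\<^sup>2 - (norm (X n))\<^sup>2" for n
    using norm_disjoint_sum_power2[OF Xc, of "f (X n)" n] adm[of n] by (simp add: XS adm_def)
  have "X n \<le> X (Suc n)" for n
    using adm[of n] componentD(1)[of "f (X n)" "q - X n"] by (simp add: XS adm_def)
  moreover have "norm (X n) \<le> sqrt b" for n using Xb[of n] by (rule real_le_rsqrt)
  ultimately obtain r where r: "X \<longlonglongrightarrow> r" "\<And>n. X n \<le> r"
    using increasing_bounded_convergent[of X "sqrt b"] componentD(1)[OF Xc] by blast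
  have rq: "component r q" by (rule component_LIMSEQ[OF r(1) Xc])
  have lim: "(\<lambda>n. (norm (X n))\<^sup>2) \<longlonglongrightarrow> (norm r)\<^sup>2" by (intro tendsto_intros r)
  have rb: "(norm r)\<^sup>2 \<le> b" by (rule LIMSEQ_le_const2[OF lim]) (use Xb in blast)
  have "(norm r)\<^sup>2 = b"
  proof (rule ccontr)
    assume "(norm r)\<^sup>2 \<noteq> b"
    with rb have lt: "(norm r)\<^sup>2 < b" by simp
    with b have "q - r \<noteq> 0" by auto
    then obtain d where d: "component d (q - r)" "d \<noteq> 0" "(norm d)\<^sup>2 < b - (norm r)\<^sup>2"
      using small_component_exists[OF nonatomic component_trans[OF component_complement[OF rq] q]] lt
      by (metis diff_gt_0_iff_gt)
    \<comment> \<open>The piece \<open>d\<close> is admissible in every step, so every step is at least half as large as \<open>d\<close>. But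
      the steps tend to zero.\<close>
    have "(norm d)\<^sup>2 \<le> 2 * ((norm (X (Suc n)))\<^sup>2 - (norm (X n))\<^sup>2)" for n
    proof -
      have sub: "component (q - r) (q - X n)"
        using r(2)[of n] componentD(1)[OF Xc, of n]
        by (intro component_of_smaller[OF component_complement[OF rq]]) simp_all
      have "norm (X n) \<le> norm r"
        using r(2)[of n] componentD(1)[OF Xc, of n] componentD(1)[OF rq]
        by (intro norm_lattice) simp
      then have "(norm (X n))\<^sup>2 \<le> (norm r)\<^sup>2" by (simp add: power_mono)
      with d(3) have "(norm d)\<^sup>2 \<le> b - (norm (X n))\<^sup>2" by linarith
      then have "adm (X n) d" using component_trans[OF d(1) sub] by (simp add: adm_def)
      from f(2)[OF Xc Xb this] show ?thesis by (simp add: step)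
    qed
    moreover have "(\<lambda>n. 2 * ((norm (X (Suc n)))\<^sup>2 - (norm (X n))\<^sup>2)) \<longlonglongrightarrow> 2 * ((norm r)\<^sup>2 - (norm r)\<^sup>2)"
      by (intro tendsto_intros lim LIMSEQ_Suc[OF lim] r LIMSEQ_Suc[OF r(1)])
    ultimately have "(norm d)\<^sup>2 \<le> 2 * ((norm r)\<^sup>2 - (norm r)\<^sup>2)"
      by (meson LIMSEQ_le_const)
    then show False using d(2) by simp
  qed
  with that rq show thesis by blast
qed

text \<open>The tree below \<open>w\<close> copies all ratios of squared norms from \<open>p\<close>, by splitting each node in the
  prescribed proportion.\<close>

lemma matching_tree:
  fixes p :: "bool list \<Rightarrow> 'a::hilbert_lattice" and w :: 'a
  assumes nonatomic: "\<And>a. component a w \<Longrightarrow> \<not> atom a" and w: "0 \<le> w"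
    and p: "splitting p" and \<kappa>: "0 \<le> \<kappa>" "(norm w)\<^sup>2 = \<kappa> * (norm (p []))\<^sup>2"
  obtains q :: "bool list \<Rightarrow> 'a" where "splitting q" "\<And>s. component (q s) w" "\<And>s. (norm (q s))\<^sup>2 = \<kappa> * (norm (p s))\<^sup>2"
proof -
  have pp: "(norm (p s))\<^sup>2 = (norm (p (True # s)))\<^sup>2 + (norm (p (False # s)))\<^sup>2" for s
    using splittingD(3)[OF p, of s] unfolding splittingD(2)[OF p, of s, symmetric]
    by (simp add: power2_norm_eq_inner inner_add_left inner_add_right inner_commute)
  define f where "f s a = (SOME r. component r a \<and> (norm r)\<^sup>2 = \<kappa> * (norm (p (True # s)))\<^sup>2)"
    for s and a :: 'a
  define q where "q = split_tree f w"
  have f: "component (f s a) a \<and> (norm (f s a))\<^sup>2 = \<kappa> * (norm (p (True # s)))\<^sup>2"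
    if a: "component a w" "(norm a)\<^sup>2 = \<kappa> * (norm (p s))\<^sup>2" for s a
  proof -
    have "\<kappa> * (norm (p (True # s)))\<^sup>2 \<le> (norm a)\<^sup>2"
      unfolding a(2) using \<kappa> pp[of s] by (intro mult_left_mono) simp_all
    moreover have "0 \<le> \<kappa> * (norm (p (True # s)))\<^sup>2" using \<kappa> by simp
    ultimately have "\<exists>r. component r a \<and> (norm r)\<^sup>2 = \<kappa> * (norm (p (True # s)))\<^sup>2"
      using component_of_prescribed_norm[OF nonatomic a(1)] by metis
    then show ?thesis unfolding f_def by (rule someI_ex)
  qed
  have q: "component (q s) w \<and> (norm (q s))\<^sup>2 = \<kappa> * (norm (p s))\<^sup>2" for s
  proof (induction s)
    case Nil show ?case using component_refl[OF w] \<kappa> by (simp add: q_def)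
  next
    case (Cons b s)
    define r where "r = f s (q s)"
    have r: "component r (q s)" "(norm r)\<^sup>2 = \<kappa> * (norm (p (True # s)))\<^sup>2"
      using f[of "q s" s] Cons by (auto simp: r_def)
    have "(norm (q s - r))\<^sup>2 = \<kappa> * (norm (p (False # s)))\<^sup>2"
      using norm_component_power2[OF r(1)] r(2) Cons pp[of s] by (simp add: distrib_left)
    moreover have "component r w" "component (q s - r) w"
      using component_trans[OF r(1)] component_trans[OF component_complement[OF r(1)]] Cons by auto
    moreover have "q (True # s) = r" "q (False # s) = q s - r" by (simp_all add: q_def r_def)
    ultimately show ?case using r(2) by (cases b) simp_all
  qed
  have "splitting q" unfolding q_def
    by (rule splitting_split_tree[of _ _ w]) (use q f in \<open>auto simp: q_def\<close>)
  with that q show thesis by blast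
qed

text \<open>The values on the nodes are recorded to be dominated by a fixed multiple of \<open>w\<close>, as this is how
  \<open>band_projection\<close> recognises membership in the band of \<open>w\<close>.\<close>

lemma isometry_into_nonatomic:
  fixes p :: "bool list \<Rightarrow> 'a::hilbert_lattice" and w :: 'a
  assumes sys: "refining_system p level" and p: "splitting p"
    and nonatomic: "\<And>a. component a w \<Longrightarrow> \<not> atom a"
    and w: "0 \<le> w" "w \<noteq> 0" and p0: "p [] \<noteq> 0"
  obtains S :: "'a \<Rightarrow> 'a" and c where "positive_operator S" "\<And>x y. S x \<bullet> S y = x \<bullet> y" "bounded_linear S"
    "\<And>s. 0 \<le> S (p s)" "\<And>s. S (p s) \<le> c *\<^sub>R w" "0 \<le> c"
proof -
  interpret refining_system p level by fact
  define \<kappa> where "\<kappa> = (norm w)\<^sup>2 / (norm (p []))\<^sup>2"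
  have \<kappa>: "0 < \<kappa>" "(norm w)\<^sup>2 = \<kappa> * (norm (p []))\<^sup>2" using w p0 by (simp_all add: \<kappa>_def)
  obtain q :: "bool list \<Rightarrow> 'a" where q: "splitting q" "\<And>s. component (q s) w" "\<And>s. (norm (q s))\<^sup>2 = \<kappa> * (norm (p s))\<^sup>2"
    using matching_tree[OF nonatomic w(1) p less_imp_le[OF \<kappa>(1)] \<kappa>(2)] by blast
  define c where "c = 1 / sqrt \<kappa>"
  have c: "0 < c" using \<kappa>(1) by (simp add: c_def)
  define q' where "q' s = c *\<^sub>R q s" for s
  have "splitting q'"
    unfolding splitting_def
  proof (intro allI conjI)
    fix s
    show "0 \<le> q' s" using splittingD(1)[OF q(1)] c by (simp add: q'_def scaleR_nonneg_nonneg)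
    show "q' s = q' (True # s) + q' (False # s)"
      by (simp add: q'_def splittingD(2)[OF q(1)] flip: scaleR_add_right)
    show "q' (True # s) \<bullet> q' (False # s) = 0" by (simp add: q'_def splittingD(3)[OF q(1)])
  qed
  moreover have norm: "norm (q' s) = norm (p s)" for s
  proof -
    have "norm (q s) = sqrt (\<kappa> * (norm (p s))\<^sup>2)" by (simp flip: q(3))
    then show ?thesis using \<kappa>(1) by (simp add: q'_def c_def real_sqrt_mult)
  qed
  ultimately have compat: "compatible q'" using splitting_compatible[OF sys p] by simp
  obtain S :: "'a \<Rightarrow> 'a" where S: "positive_operator S" "\<And>x y. S x \<bullet> S y = x \<bullet> y" "bounded_linear S"
    "\<And>n s. s \<in> level n \<Longrightarrow> S (p s) = q' s"
    using extend_isometry[OF compat norm] by blast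
  have Sp: "S (p s) = q' s" for s using S(4)[of s "length s"] by (simp add: level_def)
  have "0 \<le> S (p s)" "S (p s) \<le> c *\<^sub>R w" for s
    using componentD[OF q(2)[of s]] c
    by (simp_all add: Sp q'_def scaleR_nonneg_nonneg scaleR_left_mono)
  with that S(1-3) c show thesis by (meson less_imp_le)
qed

text \<open>The projection onto the band of \<open>w\<close> is prescribed on the tree by \<open>p s \<mapsto> inf (p s) w\<close>. The children
  are disjoint, so this is again a splitting. Elements dominated by a multiple of \<open>w\<close> are orthogonal
  to \<open>p s - inf (p s) w\<close>, which lies below \<open>e - w\<close>; by symmetry and totality the projection fixes
  them.\<close>

lemma band_projection:
  fixes p :: "bool list \<Rightarrow> 'a::hilbert_lattice" and w :: 'a
  assumes sys: "refining_system p level" and p: "splitting p"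
    and pe: "\<And>s. component (p s) e" and w: "component w e"
  obtains P :: "'a \<Rightarrow> 'a" where "bounded_linear P" "positive_operator P" "positive_operator (\<lambda>x. x - P x)"
    "\<And>x y. P x \<bullet> y = x \<bullet> P y"
    "\<And>x c. 0 \<le> c \<Longrightarrow> 0 \<le> x \<Longrightarrow> x \<le> c *\<^sub>R w \<Longrightarrow> P x = x"
    "\<And>x c. 0 \<le> c \<Longrightarrow> 0 \<le> x \<Longrightarrow> x \<le> c *\<^sub>R (e - w) \<Longrightarrow> P x = 0"
    "\<And>x. P (P x) = P x"
proof -
  interpret refining_system p level by fact
  have w0: "0 \<le> w" using w by (rule componentD)
  have p0: "0 \<le> p s" for s using pe by (rule componentD)
  have "norm (inf (p s) w) \<le> norm (p s)" for s
    using p0[of s] w0 by (intro norm_lattice) simp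
  then have compat: "compatible (\<lambda>s. inf (p s) w)"
    by (rule splitting_compatible[OF sys p splitting_inf[OF p w0]])
  obtain P :: "'a \<Rightarrow> 'a" where P: "bounded_linear P" "positive_operator P"
    "\<And>n s. s \<in> level n \<Longrightarrow> P (p s) = inf (p s) w"
    "\<And>x. (\<lambda>n. expand (\<lambda>s. inf (p s) w) n x) \<longlonglongrightarrow> P x"
    using extend_compatible[OF compat] by blast
  have Pp: "P (p s) = inf (p s) w" for s using P(3)[of s "length s"] by (simp add: level_def)
  have blQ: "bounded_linear (\<lambda>x. x - P x)"
    by (intro bounded_linear_sub bounded_linear_ident P(1))
  have Q: "positive_operator (\<lambda>x. x - P x)"
  proof (rule positive_if_nonneg_on_system[OF blQ])
    show "0 \<le> p s - P (p s)" for s by (simp only: Pp diff_ge_0_iff_ge inf_le1)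
  qed
  have sym: "P x \<bullet> y = x \<bullet> P y" for x y
  proof (rule symmetric_if_symmetric_on_system[OF P(1)])
    fix n s t assume st: "s \<in> level n" "t \<in> level n"
    show "P (p s) \<bullet> p t = p s \<bullet> P (p t)"
    proof (cases "s = t")
      case False
      have "inf (p s) w \<bullet> p t = 0" "p s \<bullet> inf (p t) w = 0"
        using p0 w0 by (auto intro!: inner_zero_mono[OF orth[OF st False]])
      then show ?thesis by (simp add: Pp)
    qed (simp add: inner_commute)
  qed
  have on_w: "P x = x" if x: "0 \<le> c" "0 \<le> x" "x \<le> c *\<^sub>R w" for x c
  proof -
    have "x - P x = 0"
    proof (rule total)
      fix n s assume "s \<in> level n"
      have le: "p s - inf (p s) w \<le> e - w"
      proof -
        have "p s + w = sup (p s) w + inf (p s) w" by (rule add_eq_inf_sup)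
        then have "p s - inf (p s) w = sup (p s) w - w" by (simp only: diff_eq_eq eq_diff_eq diff_add_eq)
        also have "\<dots> \<le> e - w" using componentD(2)[OF pe] componentD(2)[OF w]
          by (intro diff_right_mono) simp
        finally show ?thesis .
      qed
      have "p s \<bullet> (x - P x) = (p s - P (p s)) \<bullet> x"
        by (simp only: inner_diff_left inner_diff_right sym)
      also have "\<dots> = 0"
      proof (rule inner_zero_mono)
        show "(e - w) \<bullet> (c *\<^sub>R w) = 0" using componentD(3)[OF w] by (simp add: inner_commute)
        show "0 \<le> p s - P (p s)" by (simp only: Pp diff_ge_0_iff_ge inf_le1)
        show "p s - P (p s) \<le> e - w" using le by (simp only: Pp)
      qed (use x in auto)
      finally show "p s \<bullet> (x - P x) = 0" .
    qed
    then show ?thesis by simp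
  qed
  have off_w: "P x = 0" if x: "0 \<le> c" "0 \<le> x" "x \<le> c *\<^sub>R (e - w)" for x c
  proof (rule total)
    fix n s assume "s \<in> level n"
    have "p s \<bullet> P x = inf (p s) w \<bullet> x" by (simp add: Pp flip: sym)
    also have "\<dots> = 0"
    proof (rule inner_zero_mono)
      show "w \<bullet> (c *\<^sub>R (e - w)) = 0" using componentD(3)[OF w] by simp
    qed (use x p0 w0 in auto)
    finally show "p s \<bullet> P x = 0" .
  qed
  have "P (P x) - P x = 0" for x
  proof (rule eq_0_if_eq_0_on_system[of "\<lambda>x. P (P x) - P x"])
    show "bounded_linear (\<lambda>x. P (P x) - P x)"
      by (intro bounded_linear_sub bounded_linear_compose[OF P(1) P(1)] P(1))
    show "P (P (p s)) - P (p s) = 0" for s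
      using on_w[of 1 "P (p s)"] p0 w0 by (simp add: Pp)
  qed
  with that[OF P(1,2) Q sym on_w off_w] show thesis by simp
qed

text \<open>Two halves of a nonatomic component both contain a copy of the whole lattice, whatever atoms the
  lattice may have elsewhere. The rest of the lattice is assigned to the complement of the first half.\<close>

lemma copies_if_nonatomic_component:
  assumes sep: "separable_space (euclidean :: 'a::hilbert_lattice topology)"
    and e: "weak_unit (e :: 'a::hilbert_lattice)"
    and w: "component w e" "w \<noteq> 0" and nonatomic: "\<And>a. component a w \<Longrightarrow> \<not> atom a"
  obtains P S T :: "'a::hilbert_lattice \<Rightarrow> 'a" where "complementary_copies P S T"
proof -
  obtain p :: "bool list \<Rightarrow> 'a" where sys: "refining_system p level" and p: "splitting p" "p [] = e" "\<And>s. component (p s) e"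
    using component_tree_exists[OF sep e] by blast
  interpret refining_system p level by fact
  have e0: "e \<noteq> 0" using w componentD[OF w(1)] by (metis order.antisym)
  obtain w1 where w1: "component w1 w" "(norm w1)\<^sup>2 = (norm w)\<^sup>2 / 2"
    using component_of_prescribed_norm[OF nonatomic component_refl[OF componentD(1)[OF w(1)]],
        of "(norm w)\<^sup>2 / 2"] by auto
  define w2 where "w2 = w - w1"
  have w2: "component w2 w" using component_complement[OF w1(1)] by (simp add: w2_def)
  have "(norm w2)\<^sup>2 = (norm w)\<^sup>2 / 2"
    using norm_component_power2[OF w1(1)] w1(2) by (simp add: w2_def)
  then have ne: "w1 \<noteq> 0" "w2 \<noteq> 0" using w1(2) w(2) by auto
  have na: "\<not> atom a" if "component a w1 \<or> component a w2" for a
    using that nonatomic component_trans w1(1) w2 by blast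
  obtain S :: "'a \<Rightarrow> 'a" and c where S: "positive_operator S" "\<And>x y. S x \<bullet> S y = x \<bullet> y" "bounded_linear S"
    "\<And>s. 0 \<le> S (p s)" "\<And>s. S (p s) \<le> c *\<^sub>R w1" "0 \<le> c"
  proof (rule isometry_into_nonatomic[OF sys p(1)])
    show "\<not> atom a" if "component a w1" for a using na that by blast
  qed (use ne(1) componentD(1)[OF w1(1)] p(2) e0 in auto)
  obtain T :: "'a \<Rightarrow> 'a" and d where T: "positive_operator T" "\<And>x y. T x \<bullet> T y = x \<bullet> y" "bounded_linear T"
    "\<And>s. 0 \<le> T (p s)" "\<And>s. T (p s) \<le> d *\<^sub>R w2" "0 \<le> d"
  proof (rule isometry_into_nonatomic[OF sys p(1)])
    show "\<not> atom a" if "component a w2" for a using na that by blast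
  qed (use ne(2) componentD(1)[OF w2] p(2) e0 in auto)
  obtain P :: "'a \<Rightarrow> 'a" where P: "bounded_linear P" "positive_operator P" "positive_operator (\<lambda>x. x - P x)"
    "\<And>x y. P x \<bullet> y = x \<bullet> P y"
    "\<And>x c. 0 \<le> c \<Longrightarrow> 0 \<le> x \<Longrightarrow> x \<le> c *\<^sub>R w1 \<Longrightarrow> P x = x"
    "\<And>x c. 0 \<le> c \<Longrightarrow> 0 \<le> x \<Longrightarrow> x \<le> c *\<^sub>R (e - w1) \<Longrightarrow> P x = 0"
    "\<And>x. P (P x) = P x"
    using band_projection[OF sys p(1,3) component_trans[OF w1(1) w(1)]] by blast
  have "P (S x) - S x = 0" for x
  proof (rule eq_0_if_eq_0_on_system[of "\<lambda>x. P (S x) - S x"])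
    show "bounded_linear (\<lambda>x. P (S x) - S x)"
      by (intro bounded_linear_sub bounded_linear_compose[OF P(1) S(3)] S(3))
    show "P (S (p s)) - S (p s) = 0" for s using P(5)[OF S(6,4,5)] by simp
  qed
  moreover have "P (T x) = 0" for x
  proof (rule eq_0_if_eq_0_on_system[of "\<lambda>x. P (T x)"])
    show "bounded_linear (\<lambda>x. P (T x))" by (rule bounded_linear_compose[OF P(1) T(3)])
    show "P (T (p s)) = 0" for s
    proof (rule P(6)[OF T(6,4)])
      have "d *\<^sub>R w2 \<le> d *\<^sub>R (e - w1)"
        using componentD(2)[OF w(1)] T(6) by (intro scaleR_left_mono) (simp_all add: w2_def)
      with T(5)[of s] show "T (p s) \<le> d *\<^sub>R (e - w1)" by (rule order_trans)
    qed
  qed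
  ultimately have "complementary_copies P S T"
    using P S(1,2) T(1,2) by (simp add: complementary_copies_def)
  then show thesis by (rule that)
qed

section \<open>Atomic lattices\<close>

lemma atoms_orthogonal:
  fixes a b :: "'a::hilbert_lattice"
  assumes a: "component a e" "atom a" and b: "component b e" "atom b" and ne: "a \<noteq> b"
  shows "a \<bullet> b = 0"
proof -
  have "component (inf a b) a" by (rule component_inf_left[OF a(1) b(1)])
  then have 1: "inf a b = 0 \<or> inf a b = a" using a(2) by (simp add: atom_def)
  have "component (inf b a) b" by (rule component_inf_left[OF b(1) a(1)])
  then have "inf b a = 0 \<or> inf b a = b" using b(2) by (simp add: atom_def)
  then have 2: "inf a b = 0 \<or> inf a b = b" by (simp only: inf_commute)
  from 1 2 ne have "inf a b = 0" by metis
  then show ?thesis by (rule inner_eq_0_if_inf_eq_0)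
qed

text \<open>The atoms are orthogonal, and each satisfies \<open>a \<bullet> e = a \<bullet> a\<close>. So the squared norms of finitely many
  of them add up to at most \<open>(norm e)\<^sup>2\<close>, and a summable family has countable support.\<close>

lemma countable_atoms:
  fixes e :: "'a::hilbert_lattice"
  shows "countable {a. component a e \<and> atom a}" (is "countable ?A")
proof -
  have "(\<Sum>a\<in>F. (norm a)\<^sup>2) \<le> (norm e)\<^sup>2" if F: "F \<subseteq> ?A" "finite F" for F
  proof -
    define u where "u = \<Sum>F"
    have "(norm u)\<^sup>2 = (\<Sum>a\<in>F. (norm a)\<^sup>2)"
      unfolding u_def
      by (rule norm_sum_Pythagorean[OF F(2)])
        (use F(1) in \<open>auto simp: pairwise_def orthogonal_def subset_iff intro!: atoms_orthogonal[of _ e]\<close>)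
    moreover have "(\<Sum>a\<in>F. (norm a)\<^sup>2) = (\<Sum>a\<in>F. a \<bullet> e)"
      using F(1) by (intro sum.cong refl)
        (auto simp: component_def power2_norm_eq_inner inner_diff_right)
    moreover have "(\<Sum>a\<in>F. a \<bullet> e) = u \<bullet> e" by (simp add: u_def inner_sum_left)
    ultimately have eq: "(norm u)\<^sup>2 = u \<bullet> e" "(\<Sum>a\<in>F. (norm a)\<^sup>2) = u \<bullet> e" by simp_all
    have "norm u * norm u \<le> norm u * norm e"
      using norm_cauchy_schwarz[of u e] eq(1) by (simp add: power2_eq_square)
    then have "norm u \<le> norm e" by (cases "norm u = 0") simp_all
    then have "(norm u)\<^sup>2 \<le> (norm e)\<^sup>2" by (simp add: power_mono)
    then show ?thesis using eq by simp
  qed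
  then have "bdd_above (sum (\<lambda>a. (norm a)\<^sup>2) ` {F. F \<subseteq> ?A \<and> finite F})"
    by (intro bdd_aboveI2[of _ _ "(norm e)\<^sup>2"]) auto
  then have "(\<lambda>a. (norm a)\<^sup>2) summable_on ?A" by (intro nonneg_bdd_above_summable_on) auto
  then have "countable {a \<in> ?A. (norm a)\<^sup>2 \<noteq> 0}" by (intro abs_summable_countable) simp
  moreover have "{a \<in> ?A. (norm a)\<^sup>2 \<noteq> 0} = ?A" by (auto simp: atom_def)
  ultimately show ?thesis by simp
qed

text \<open>The isometries send the \<open>i\<close>-th basis vector to the ones with numbers \<open>2i\<close> and \<open>2i + 1\<close>, and \<open>P\<close>
  keeps the vectors with even numbers.\<close>

lemma copies_if_positive_basis:
  fixes b :: "nat \<Rightarrow> 'a::hilbert_lattice"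
  assumes b0: "\<And>i. 0 \<le> b i" and norm: "\<And>i. norm (b i) = 1"
    and orth: "\<And>i j. i \<noteq> j \<Longrightarrow> b i \<bullet> b j = 0"
    and total: "\<And>x. (\<And>i. b i \<bullet> x = 0) \<Longrightarrow> x = 0"
  obtains P S T :: "'a \<Rightarrow> 'a" where "complementary_copies P S T"
proof -
  define I where "I n = {..<n}" for n :: nat
  have inner: "b i \<bullet> b j = (if i = j then 1 else 0)" for i j
    using norm[of i] orth[of i j] by (auto simp: norm_eq_1)
  have kronecker: "(\<Sum>t\<in>I (Suc n). ((b t \<bullet> b s) / (b t \<bullet> b t)) *\<^sub>R q t) = q s"
    if "s \<in> I n" for n s and q :: "nat \<Rightarrow> 'a"
  proof -
    have "(\<Sum>t\<in>I (Suc n). ((b t \<bullet> b s) / (b t \<bullet> b t)) *\<^sub>R q t) = (\<Sum>t\<in>I (Suc n). if t = s then q t else 0)"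
      by (intro sum.cong refl) (simp add: inner)
    then show ?thesis using that by (simp add: I_def)
  qed
  interpret refining_system b I
  proof
    show "finite (I n)" for n by (simp add: I_def)
    show "x = 0" if "\<And>n s. s \<in> I n \<Longrightarrow> b s \<bullet> x = 0" for x
    proof (rule total)
      show "b i \<bullet> x = 0" for i using that[of i "Suc i"] by (simp add: I_def)
    qed
  qed (use b0 orth kronecker in auto)
  have in_I: "i \<in> I (Suc i)" for i by (simp add: I_def)
  have iso: "\<exists>S. positive_operator S \<and> (\<forall>x y. S x \<bullet> S y = x \<bullet> y) \<and> bounded_linear S \<and>
      (\<forall>i. S (b i) = b (h i))" if h: "inj h" for h
  proof -
    have compat: "compatible (\<lambda>i. b (h i))"
      unfolding compatible_def using b0 norm kronecker by (auto simp: inner inj_eq[OF h])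
    have "norm (b (h i)) = norm (b i)" for i by (simp add: norm)
    then obtain S :: "'a \<Rightarrow> 'a" where "positive_operator S" "\<And>x y. S x \<bullet> S y = x \<bullet> y" "bounded_linear S"
      "\<And>n s. s \<in> I n \<Longrightarrow> S (b s) = b (h s)"
      using extend_isometry[OF compat] by blast
    then show ?thesis using in_I by blast
  qed
  have "inj (\<lambda>i::nat. 2 * i)" "inj (\<lambda>i::nat. 2 * i + 1)" by (auto intro: injI)
  from iso[OF this(1)] iso[OF this(2)]
  obtain S T :: "'a \<Rightarrow> 'a" where S: "positive_operator S" "\<And>x y. S x \<bullet> S y = x \<bullet> y" "bounded_linear S"
    "\<And>i. S (b i) = b (2 * i)"
    and T: "positive_operator T" "\<And>x y. T x \<bullet> T y = x \<bullet> y" "bounded_linear T"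
    "\<And>i. T (b i) = b (2 * i + 1)"
    by blast
  define q where "q i = (if even i then b i else 0)" for i
  have compat: "compatible q" unfolding compatible_def
    using b0 norm kronecker[of _ _ q] by (auto simp: q_def inner)
  obtain P :: "'a \<Rightarrow> 'a" where P: "bounded_linear P" "positive_operator P" "\<And>n s. s \<in> I n \<Longrightarrow> P (b s) = q s"
    "\<And>x. (\<lambda>n. expand q n x) \<longlonglongrightarrow> P x"
    using extend_compatible[OF compat] by blast
  have Pb: "P (b i) = q i" for i using P(3)[OF in_I] .
  have blQ: "bounded_linear (\<lambda>x. x - P x)"
    by (intro bounded_linear_sub bounded_linear_ident P(1))
  have Q: "positive_operator (\<lambda>x. x - P x)"
    by (rule positive_if_nonneg_on_system[OF blQ]) (simp add: Pb q_def b0)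
  have sym: "P x \<bullet> y = x \<bullet> P y" for x y
    by (rule symmetric_if_symmetric_on_system[OF P(1)]) (simp add: Pb q_def inner)
  have "P 0 = 0" using P(1) by (simp add: bounded_linear.linear linear_0)
  have "P (P x) - P x = 0" for x
  proof (rule eq_0_if_eq_0_on_system[of "\<lambda>x. P (P x) - P x"])
    show "bounded_linear (\<lambda>x. P (P x) - P x)"
      by (intro bounded_linear_sub bounded_linear_compose[OF P(1) P(1)] P(1))
    show "P (P (b i)) - P (b i) = 0" for i using \<open>P 0 = 0\<close> by (simp add: Pb q_def)
  qed
  moreover have "P (S x) - S x = 0" for x
  proof (rule eq_0_if_eq_0_on_system[of "\<lambda>x. P (S x) - S x"])
    show "bounded_linear (\<lambda>x. P (S x) - S x)"
      by (intro bounded_linear_sub bounded_linear_compose[OF P(1) S(3)] S(3))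
    show "P (S (b i)) - S (b i) = 0" for i by (simp add: Pb q_def S(4))
  qed
  moreover have "P (T x) = 0" for x
  proof (rule eq_0_if_eq_0_on_system[of "\<lambda>x. P (T x)"])
    show "bounded_linear (\<lambda>x. P (T x))" by (rule bounded_linear_compose[OF P(1) T(3)])
    show "P (T (b i)) = 0" for i by (simp add: Pb q_def T(4))
  qed
  ultimately have "complementary_copies P S T"
    using P(2) Q sym S(1,2) T(1,2) by (simp add: complementary_copies_def)
  then show thesis by (rule that)
qed

text \<open>An atom lies below every nonzero component, so the atoms form a total orthogonal system. If there
  were only finitely many, they would span the lattice.\<close>

lemma copies_if_atomic:
  assumes dim: "infinite_dimensional TYPE('a::hilbert_lattice)"
    and e: "weak_unit (e :: 'a)"
    and atomic: "\<And>w. component w e \<Longrightarrow> w \<noteq> 0 \<Longrightarrow> \<exists>a. component a w \<and> atom a"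
  obtains P S T :: "'a::hilbert_lattice \<Rightarrow> 'a" where "complementary_copies P S T"
proof -
  define A where "A = {a. component a e \<and> atom a}"
  have A0: "0 \<le> a" "a \<noteq> 0" if "a \<in> A" for a using that by (auto simp: A_def component_def atom_def)
  have orth: "a \<bullet> b = 0" if "a \<in> A" "b \<in> A" "a \<noteq> b" for a b
    using that atoms_orthogonal by (auto simp: A_def)
  have total: "x = 0" if x: "\<And>a. a \<in> A \<Longrightarrow> a \<bullet> x = 0" for x
  proof (rule eq_0_if_orthogonal_to_small_elements[OF e x])
    fix p assume p: "component p e" "p \<noteq> 0"
    then obtain a where a: "component a p" "atom a" using atomic by blast
    then have "a \<in> A" using component_trans p(1) by (auto simp: A_def)
    with a show "\<exists>a\<in>A. 0 \<le> a \<and> a \<le> p \<and> a \<noteq> 0"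
      using componentD[OF a(1)] A0 by blast
  qed
  have "infinite A"
  proof
    assume fin: "finite A"
    have "x \<in> span A" for x
    proof -
      define y where "y = (\<Sum>a\<in>A. ((a \<bullet> x) / (a \<bullet> a)) *\<^sub>R a)"
      have "x - y = 0"
      proof (rule total)
        fix a assume a: "a \<in> A"
        have "a \<bullet> y = (\<Sum>c\<in>{a}. ((c \<bullet> x) / (c \<bullet> c)) * (a \<bullet> c))"
          unfolding y_def inner_sum_right inner_scaleR_right using a orth
          by (intro sum.mono_neutral_right fin) auto
        also have "\<dots> = a \<bullet> x" using A0[OF a] by simp
        finally show "a \<bullet> (x - y) = 0" by (simp add: inner_diff_right)
      qed
      moreover have "y \<in> span A" unfolding y_def by (intro span_sum span_scale span_base)
      ultimately show ?thesis by simp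
    qed
    then show False using dim fin unfolding infinite_dimensional_def by blast
  qed
  moreover have "countable A" unfolding A_def by (rule countable_atoms)
  ultimately have bij: "bij_betw (from_nat_into A) UNIV A" by (rule bij_betw_from_nat_into[rotated])
  define a where "a = from_nat_into A"
  have aA: "a i \<in> A" for i using bij by (auto simp: a_def bij_betw_def)
  have surj: "\<exists>i. c = a i" if "c \<in> A" for c using bij that by (auto simp: a_def bij_betw_def)
  have inj: "a i \<noteq> a j" if "i \<noteq> j" for i j
    using bij that by (auto simp: a_def bij_betw_def dest: injD)
  show thesis
  proof (rule copies_if_positive_basis[of "\<lambda>i. (1 / norm (a i)) *\<^sub>R a i"])
    show "0 \<le> (1 / norm (a i)) *\<^sub>R a i" for i using A0[OF aA] by (simp add: scaleR_nonneg_nonneg)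
    show "norm ((1 / norm (a i)) *\<^sub>R a i) = 1" for i using A0[OF aA] by simp
    show "((1 / norm (a i)) *\<^sub>R a i) \<bullet> ((1 / norm (a j)) *\<^sub>R a j) = 0" if "i \<noteq> j" for i j
      using orth[OF aA aA inj[OF that]] by simp
    show "x = 0" if "\<And>i. ((1 / norm (a i)) *\<^sub>R a i) \<bullet> x = 0" for x
    proof (rule total)
      fix c assume "c \<in> A"
      then show "c \<bullet> x = 0" using surj[of c] that A0[OF aA] by auto
    qed
  qed (rule that)
qed

section \<open>Positive central operators\<close>

theorem theorem5p2:
  fixes C :: "'a::hilbert_lattice \<Rightarrow> 'a"
  assumes "infinite_dimensional TYPE('a)"
    and "separable_space (euclidean :: 'a topology)"
    and "positive_operator C"
    and "central_operator C"
  shows "\<exists>A B :: 'a \<Rightarrow> 'a.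
      bounded_linear A \<and> bounded_linear B \<and>
      positive_operator A \<and> positive_operator B \<and>
      positive_operator (self_commutator A) \<and> positive_operator (self_commutator B) \<and>
      C = (\<lambda>x. self_commutator A x + self_commutator B x)"
proof -
  obtain e :: 'a where e: "weak_unit e" by (rule weak_unit_exists[OF assms(2)])
  obtain P S T :: "'a \<Rightarrow> 'a" where copies: "complementary_copies P S T"
  proof (cases "\<exists>w. component w e \<and> w \<noteq> 0 \<and> (\<forall>a. component a w \<longrightarrow> \<not> atom a)")
    case True
    then obtain w where w: "component w e" "w \<noteq> 0" "\<And>a. component a w \<Longrightarrow> \<not> atom a" by blast
    show thesis by (rule copies_if_nonatomic_component[OF assms(2) e w that])
  next
    case False
    then have atomic: "\<And>w. component w e \<Longrightarrow> w \<noteq> 0 \<Longrightarrow> \<exists>a. component a w \<and> atom a" by blast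
    show thesis by (rule copies_if_atomic[OF assms(1) e atomic that])
  qed
  obtain p :: "bool list \<Rightarrow> 'a" where sys: "refining_system p level" and p: "splitting p" "p [] = e" "\<And>s. component (p s) e"
    using component_tree_exists[OF assms(2) e] by blast
  interpret refining_system p level by fact
  obtain r where r: "0 < r" and central: "\<And>x. \<bar>C x\<bar> \<le> r *\<^sub>R \<bar>x\<bar>"
    using assms(4) by (auto simp: central_operator_def)
  have le: "C x \<le> r *\<^sub>R x" if "0 \<le> x" for x
    using order_trans[OF abs_ge_self central[of x]] that by simp
  from sum_of_two_self_commutators[OF assms(3) le r symmetric_if_dominated[OF assms(3) less_imp_le[OF r] le] copies]
  show ?thesis .
qed

end
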